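(* Let $f(z)$ be a nonconstant entire function such that its hyper-order satisfies $\varsigma(f)<\infty$ and $\varsigma(f)\notin\mathbb{N}$, and let $a\in\mathbb{C}$. If $f(z)$ and $f'(z)$ share the value $a$ CM, then $f'(z)-a=e^{\varphi(z)}(f(z)-a)$, where $\varphi(z)$ is a constant or a transcendental entire function of finite order.
   Context: $f$ and $f'$ share the value $a$ CM if $f(z)-a$ and $f'(z)-a$ have the same zeros, counting multiplicities. The order of growth of an entire function $f$ is $\sigma(f)=\limsup_{|z|\to\infty}\frac{\log\log|f(z)|}{\log|z|}$, and when $\sigma(f)=\infty$ the hyper-order is $\varsigma(f)=\limsup_{|z|\to\infty}\frac{\log\log\log|f(z)|}{\log|z|}$ (the limsup being taken over those $z$ for which the iterated logarithms are defined); when $\sigma(f)<\infty$ one sets $\varsigma(f)=0$. $\mathbb{N}=\{1,2,3,\dots\}$. *)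

theory Defs
  imports "HOL-Complex_Analysis.Complex_Analysis"
begin

(* The limsup runs over the z at which ln (ln (norm (f z))) is defined.  In HOL ln is total
   on the reals, so this restriction has to be explicit in the filter.  For a nonconstant
   entire f the filter is proper by Liouville; for a constant of modulus at most 1 it is
   trivial and the value is -\<infinity>. *)
definition growth_order :: "(complex \<Rightarrow> complex) \<Rightarrow> ereal" where
  "growth_order f =
     Limsup (inf at_infinity (principal {z. norm (f z) > 1}))
       (\<lambda>z. ereal (ln (ln (norm (f z))) / ln (norm z)))"

(* ln (ln (ln (norm (f z)))) is defined iff norm (f z) > exp 1. *)
definition hyper_order :: "(complex \<Rightarrow> complex) \<Rightarrow> ereal" where
  "hyper_order f =
     (if growth_order f = \<infinity>
      then Limsup (inf at_infinity (principal {z. norm (f z) > exp 1}))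
             (\<lambda>z. ereal (ln (ln (ln (norm (f z)))) / ln (norm z)))
      else 0)"

(* zorder says nothing useful about a function that vanishes identically; comparing the
   zero sets first ensures that the multiplicities compared are those of isolated zeros
   whenever f and g are entire and one of them is not identically a. *)
definition share_CM :: "(complex \<Rightarrow> complex) \<Rightarrow> (complex \<Rightarrow> complex) \<Rightarrow> complex \<Rightarrow> bool" where
  "share_CM f g a \<longleftrightarrow>
     {z. f z - a = 0} = {z. g z - a = 0} \<and>
     (\<forall>z. f z - a = 0 \<longrightarrow> zorder (\<lambda>w. f w - a) z = zorder (\<lambda>w. g w - a) z)"

definition transcendental_entire :: "(complex \<Rightarrow> complex) \<Rightarrow> bool" where
  "transcendental_entire f \<longleftrightarrow> f holomorphic_on UNIV \<and> \<not> (\<exists>p. f = poly p)"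

end

theory Submission
  imports Defs "HOL-Real_Asymp.Real_Asymp"
begin

text \<open>
  Put \<open>F = f - a\<close>.  Since \<open>f\<close> and \<open>f'\<close> share \<open>a\<close> with multiplicities, \<open>(f' - a) / F\<close> extends to an entire
  function without zeros, so that \<open>f' - a = exp \<phi> * F\<close>, that is \<open>F' = exp \<phi> * F + a\<close>, with \<open>\<phi>\<close> entire.
  All zeros of \<open>F\<close> are simple.  It remains to see that \<open>\<phi>\<close> has finite order and that it is not
  a nonconstant polynomial.

  \<^emph>\<open>Finite order.\<close>  As the hyper-order is finite, \<open>F\<close> and \<open>f' - a\<close> are at most \<open>exp (exp (r\<^sup>s))\<close> on
  the circle of large radius \<open>r\<close>, for some \<open>s\<close>.  Hence the logarithm \<open>\<phi>\<close> of their quotient is at most of the size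
  of \<open>exp (r\<^sup>s)\<close>: dividing by Blaschke factors reduces to a denominator without zeros, and the
  Borel-Caratheodory inequality applies (\<open>log_quotient_bound\<close>, \<open>log_quotient_finite_order\<close>).

  \<^emph>\<open>No polynomial exponent.\<close>  Suppose that \<open>\<phi>\<close> is a polynomial \<open>p\<close> of degree \<open>n > 0\<close>.  Gronwall's
  inequality along rays shows that the hyper-order is at most \<open>n\<close> (\<open>hyper_order_poly_ode_le\<close>); as it
  differs from \<open>n\<close>, it is smaller than \<open>n\<close>, and \<open>F\<close> is at most \<open>exp (exp (r\<^sup>s))\<close> with \<open>s < n\<close>.  This forces
  \<open>F = 0\<close> (\<open>poly_ode_slow_growth_imp_zero\<close>), as follows.  In the coordinate \<open>\<zeta> = p z\<close>, which has an
  inverse on each of \<open>2 n\<close> sectors near infinity (\<open>poly_half_plane_charts\<close>), the equation reads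
  \<open>u' = (exp \<zeta> * u + a) k\<close> with \<open>k\<close> close to a multiple of \<open>\<zeta>\<^sup>1\<^sup>/\<^sup>n\<^sup>-\<^sup>1\<close>.  Where \<open>Re \<zeta> \<le> 0\<close>, integration
  along suitable paths gives \<open>u = O(\<zeta>)\<close> (\<open>decaying_ode_linear_bound\<close>).  Where \<open>Re \<zeta> \<ge> 0\<close>, there
  are horizontal lines at bounded distances from each other on which \<open>exp \<zeta> * k\<close> has nonpositive real
  part; on them the equation is not expanding, and \<open>u = O(\<zeta>)\<close> again.  Between two consecutive lines
  the Phragmen-Lindelof principle carries this bound over to the half-strip, since \<open>s < n\<close> makes
  \<open>u\<close> grow more slowly than \<open>exp (exp (d * norm \<zeta>))\<close> for every \<open>d > 0\<close> (locale
  \<open>right_half_plane_ode\<close>).  Altogether \<open>F = O(p)\<close>.  So \<open>F\<close> is a polynomial, and comparing degrees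
  in the equation gives \<open>F = 0\<close>, although \<open>f\<close> is not constant.
\<close>

section \<open>A Gronwall inequality along lines\<close>

text \<open>
  For a complex-valued solution of \<open>u' = b u + c\<close> only \<open>Re b\<close> enters the growth of \<open>norm u\<close>.  The
  function \<open>B\<close> is a primitive of an upper bound of \<open>Re b\<close>; it need not vanish at \<open>0\<close>, but its
  nonnegativity keeps the weight \<open>exp (- B t)\<close> on the inhomogeneous term below \<open>1\<close>.
\<close>
lemma gronwall_complex:
  fixes u b c :: "real \<Rightarrow> complex" and B B' :: "real \<Rightarrow> real" and L m :: real
  assumes L: "0 \<le> L"
    and u: "\<And>t. t \<in> {0..L} \<Longrightarrow> (u has_vector_derivative b t * u t + c t) (at t within {0..L})"
    and B: "\<And>t. t \<in> {0..L} \<Longrightarrow> (B has_real_derivative B' t) (at t within {0..L})"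
    and b: "\<And>t. t \<in> {0..L} \<Longrightarrow> Re (b t) \<le> B' t"
    and B0: "\<And>t. t \<in> {0..L} \<Longrightarrow> 0 \<le> B t"
    and c: "\<And>t. t \<in> {0..L} \<Longrightarrow> norm (c t) \<le> m"
  shows "norm (u L) \<le> exp (B L) * (norm (u 0) + m * L)"
proof (cases "L = 0")
  case True
  have "1 * norm (u 0) \<le> exp (B 0) * norm (u 0)"
    using B0[of 0] True by (intro mult_right_mono) auto
  then show ?thesis using True by simp
next
  case False
  then have L: "L > 0" using L by simp
  \<comment> \<open>with the integrating factor, \<open>v' = (b - B') v + exp (- B) c\<close>, and \<open>Re (b - B') \<le> 0\<close>\<close>
  define v where "v = (\<lambda>t. exp (- B t) *\<^sub>R u t)"
  define v' where "v' = (\<lambda>t. (b t - of_real (B' t)) * v t + exp (- B t) *\<^sub>R c t)"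
  have v: "(v has_vector_derivative v' t) (at t within {0..L})" if t: "t \<in> {0..L}" for t
    unfolding v_def
    by (rule derivative_eq_intros u[OF t] B[OF t] refl)+
       (simp add: v'_def v_def algebra_simps scaleR_conv_of_real)
  have inn: "v t \<bullet> v' t \<le> m * norm (v t)" if t: "t \<in> {0..L}" for t
  proof -
    have "v t \<bullet> v' t = (Re (b t) - B' t) * (v t \<bullet> v t) + v t \<bullet> (exp (- B t) *\<^sub>R c t)"
      by (simp add: v'_def inner_complex_def algebra_simps)
    also have "(Re (b t) - B' t) * (v t \<bullet> v t) \<le> 0"
      using b[OF t] by (intro mult_nonpos_nonneg) auto
    also have "v t \<bullet> (exp (- B t) *\<^sub>R c t) \<le> norm (v t) * norm (exp (- B t) *\<^sub>R c t)"
      by (rule norm_cauchy_schwarz)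
    also have "norm (exp (- B t) *\<^sub>R c t) \<le> 1 * m"
      unfolding norm_scaleR using B0[OF t] c[OF t] by (intro mult_mono) auto
    finally show ?thesis by (simp add: mult_left_mono mult.commute[of m])
  qed
  have m0: "0 \<le> m" using c[of 0] L norm_ge_zero[of "c 0"] by (simp del: norm_ge_zero)
  have key: "norm (v L) \<le> sqrt ((norm (v 0))\<^sup>2 + e) + m * L" if e: "e > 0" for e :: real
  proof -
    \<comment> \<open>a smooth substitute for \<open>norm (v t)\<close>, which need not be differentiable at zeros of \<open>v\<close>\<close>
    define s where "s = (\<lambda>t. sqrt (v t \<bullet> v t + e))"
    have pos: "v t \<bullet> v t + e > 0" for t using e by (simp add: add_nonneg_pos)
    have s: "(s has_derivative (\<lambda>h. h * ((v t \<bullet> v' t) / s t))) (at t within {0..L})"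
      if t: "t \<in> {0..L}" for t
    proof -
      have vd: "(v has_derivative (\<lambda>h. h *\<^sub>R v' t)) (at t within {0..L})"
        using v[OF t] by (simp only: has_vector_derivative_def)
      have "(\<lambda>h. v t \<bullet> (h *\<^sub>R v' t) + (h *\<^sub>R v' t) \<bullet> v t + 0) = (\<lambda>h. h * (2 * (v t \<bullet> v' t)))"
        by (rule ext) (simp add: inner_commute[of "v' t" "v t"])
      then have "((\<lambda>t. v t \<bullet> v t + e) has_derivative (\<lambda>h. h * (2 * (v t \<bullet> v' t)))) (at t within {0..L})"
        using has_derivative_add[OF has_derivative_inner[OF vd vd] has_derivative_const[of e]]
        by (simp only:)
      from has_derivative_real_sqrt[OF pos this]
      show ?thesis unfolding s_def
        by (rule has_derivative_eq_rhs) (auto simp: fun_eq_iff field_simps)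
    qed
    obtain t where t: "t \<in> {0<..<L}" and eq: "s L - s 0 = (L - 0) * ((v t \<bullet> v' t) / s t)"
      using mvt_simple[OF L, of s "\<lambda>t h. h * ((v t \<bullet> v' t) / s t)"] s by auto
    have "norm (v t) \<le> s t"
      unfolding s_def norm_eq_sqrt_inner using e by simp
    moreover have "s t > 0" unfolding s_def using pos by simp
    moreover have "v t \<bullet> v' t \<le> m * norm (v t)" using inn t by simp
    ultimately have "(v t \<bullet> v' t) / s t \<le> m"
      using m0 by (simp add: divide_le_eq) (meson mult_left_mono order_trans)
    then have "L * ((v t \<bullet> v' t) / s t) \<le> L * m" using L by (intro mult_left_mono) auto
    then have "s L \<le> s 0 + m * L" using eq by (simp add: mult.commute)
    moreover have "norm (v L) \<le> s L"
      unfolding s_def norm_eq_sqrt_inner using e by simp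
    ultimately show ?thesis by (simp add: s_def power2_norm_eq_inner)
  qed
  have "((\<lambda>e. sqrt ((norm (v 0))\<^sup>2 + e) + m * L) \<longlongrightarrow> sqrt ((norm (v 0))\<^sup>2 + 0) + m * L) (at_right 0)"
    by (intro tendsto_intros)
  then have "norm (v L) \<le> sqrt ((norm (v 0))\<^sup>2 + 0) + m * L"
    by (rule tendsto_lowerbound) (auto simp: eventually_at_right_less key intro!: eventually_at_rightI[of 0 1])
  then have "norm (v L) \<le> norm (v 0) + m * L" by simp
  also have "norm (v 0) \<le> 1 * norm (u 0)"
    unfolding v_def norm_scaleR using B0[of 0] L by (intro mult_right_mono) auto
  finally have "exp (B L) * norm (v L) \<le> exp (B L) * (norm (u 0) + m * L)" by simp
  moreover have "exp (B L) * norm (v L) = norm (u L)"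
    by (simp add: v_def exp_minus)
  ultimately show ?thesis by simp
qed

lemma has_vector_derivative_along_line:
  fixes u :: "complex \<Rightarrow> complex" and t :: real
  assumes "(u has_field_derivative D) (at (z0 + of_real t * d))"
  shows "((\<lambda>t. u (z0 + of_real t * d)) has_vector_derivative d * D) (at t within S)"
proof -
  have "((\<lambda>t. z0 + of_real t * d) has_vector_derivative d) (at t within S)"
    by (auto intro!: derivative_eq_intros)
  then show ?thesis
    using field_vector_diff_chain_within[of "\<lambda>t. z0 + of_real t * d" d t S u] assms
    by (simp add: o_def has_field_derivative_at_within)
qed

section \<open>Two maximum principles\<close>

text \<open>
  The Phragmen-Lindelof principle in a horizontal half-strip.  The growth hypothesis is stronger
  than necessary (for a strip of width \<open>w\<close> some \<open>d < pi / w\<close> would suffice), but it does not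
  depend on the width.
\<close>
lemma phragmen_lindelof_half_strip:
  fixes v :: "complex \<Rightarrow> complex" and x0 y1 y2 K :: real
  assumes y: "y1 < y2" and K: "K > 0"
    and hol: "v holomorphic_on {z. Re z > x0 \<and> y1 < Im z \<and> Im z < y2}"
    and cont: "continuous_on {z. Re z \<ge> x0 \<and> y1 \<le> Im z \<and> Im z \<le> y2} v"
    and left: "\<And>z. Re z = x0 \<Longrightarrow> y1 \<le> Im z \<Longrightarrow> Im z \<le> y2 \<Longrightarrow> norm (v z) \<le> K"
    and sides: "\<And>z. Re z \<ge> x0 \<Longrightarrow> Im z = y1 \<or> Im z = y2 \<Longrightarrow> norm (v z) \<le> K"
    and growth: "\<And>d. d > 0 \<Longrightarrow> \<exists>X. \<forall>z. Re z \<ge> X \<and> y1 \<le> Im z \<and> Im z \<le> y2 \<longrightarrow>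
                    norm (v z) \<le> exp (exp (d * Re z))"
    and z: "Re z \<ge> x0" "y1 \<le> Im z" "Im z \<le> y2"
  shows "norm (v z) \<le> K"
proof -
  \<comment> \<open>on the strip, \<open>exp (d (w - \<i> m))\<close> has argument at most \<open>1/2\<close> in absolute value, so
     that \<open>E e\<close> decays doubly exponentially\<close>
  define d where "d = 1 / (y2 - y1)"
  define m where "m = (y1 + y2) / 2"
  define E where "E = (\<lambda>e w. exp (- of_real e * exp (of_real d * (w - \<i> * of_real m))))"
  have d: "d > 0" using y by (simp add: d_def)
  define c where "c = cos (1/2::real)"
  have c: "c > 0" unfolding c_def using pi_gt3 by (intro cos_gt_zero) auto
  have nE: "norm (E e w) \<le> exp (- e * c * exp (d * Re w))"
    if "e > 0" "y1 \<le> Im w" "Im w \<le> y2" for e w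
  proof -
    have "\<bar>d * (Im w - m)\<bar> \<le> 1/2"
    proof -
      have "\<bar>Im w - m\<bar> \<le> (y2 - y1) / 2"
        using that by (auto simp: m_def abs_le_iff field_simps)
      then show ?thesis using y by (simp add: d_def abs_mult field_simps)
    qed
    then have "c \<le> cos (d * (Im w - m))"
      unfolding c_def using pi_gt3 cos_monotone_0_pi_le[of "\<bar>d * (Im w - m)\<bar>" "1/2"] by simp
    then have "e * exp (d * Re w) * c \<le> e * exp (d * Re w) * cos (d * (Im w - m))"
      using that by (intro mult_left_mono) auto
    then show ?thesis
      by (simp add: E_def Re_exp algebra_simps)
  qed
  have nE1: "norm (E e w) \<le> 1" if "e > 0" "y1 \<le> Im w" "Im w \<le> y2" for e w
    by (rule order_trans[OF nE[OF that]]) (use that c in auto)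
  have main: "norm (v z * E e z) \<le> K" if e: "e > 0" for e
  proof -
    obtain X1 where X1: "\<And>w. Re w \<ge> X1 \<Longrightarrow> y1 \<le> Im w \<Longrightarrow> Im w \<le> y2 \<Longrightarrow>
                           norm (v w) \<le> exp (exp (d / 2 * Re w))"
      using growth[of "d / 2"] d by auto
    have "((\<lambda>x. exp (exp (d/2 * x) - e * c * exp (d * x))) \<longlongrightarrow> 0) at_top"
      using d e c by real_asymp
    then have "eventually (\<lambda>x. exp (exp (d/2 * x) - e * c * exp (d * x)) < K) at_top"
      using K by (rule order_tendstoD)
    then have "eventually (\<lambda>x. exp (exp (d/2 * x) - e * c * exp (d * x)) < K \<and> x \<ge> X1 \<and> x \<ge> Re z \<and> x > x0) at_top"
      by (intro eventually_conj eventually_ge_at_top eventually_gt_at_top)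
    then obtain X where X: "exp (exp (d/2 * X) - e * c * exp (d * X)) < K" "X \<ge> X1" "X \<ge> Re z" "X > x0"
      by (auto simp: eventually_at_top_linorder)
    define Q where "Q = cbox (Complex x0 y1) (Complex X y2)"
    show ?thesis
    proof (rule maximum_modulus_frontier[of "\<lambda>w. v w * E e w" Q])
      have "interior Q \<subseteq> {z. Re z > x0 \<and> y1 < Im z \<and> Im z < y2}"
        by (auto simp: Q_def in_box_complex_iff)
      then show "(\<lambda>w. v w * E e w) holomorphic_on interior Q"
        unfolding E_def by (intro holomorphic_intros holomorphic_on_subset[OF hol])
      have "closure Q \<subseteq> {z. Re z \<ge> x0 \<and> y1 \<le> Im z \<and> Im z \<le> y2}"
        by (auto simp: Q_def in_cbox_complex_iff)
      then show "continuous_on (closure Q) (\<lambda>w. v w * E e w)"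
        unfolding E_def by (intro continuous_intros continuous_on_subset[OF cont])
      show "bounded Q" by (simp add: Q_def)
      show "z \<in> Q" using z X by (auto simp: Q_def in_cbox_complex_iff)
      fix w assume w: "w \<in> frontier Q"
      then have w': "x0 \<le> Re w" "Re w \<le> X" "y1 \<le> Im w" "Im w \<le> y2"
        "Re w = x0 \<or> Re w = X \<or> Im w = y1 \<or> Im w = y2"
        by (auto simp: Q_def frontier_cbox in_cbox_complex_iff in_box_complex_iff)
      show "norm (v w * E e w) \<le> K"
      proof (cases "Re w = X")
        case True
        have "norm (v w * E e w) \<le> exp (exp (d / 2 * X)) * exp (- e * c * exp (d * X))"
          unfolding norm_mult using X1[of w] nE[OF e, of w] w' True X by (intro mult_mono) auto
        also have "\<dots> = exp (exp (d/2 * X) - e * c * exp (d * X))"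
          by (simp add: exp_add[symmetric])
        also have "\<dots> \<le> K" using X by simp
        finally show ?thesis .
      next
        case False
        then have "norm (v w) \<le> K" using left[of w] sides[of w] w' by blast
        moreover have "norm (E e w) \<le> 1" using nE1[OF e] w' by blast
        ultimately have "norm (v w) * norm (E e w) \<le> K * 1"
          using K by (intro mult_mono) auto
        then show ?thesis by (simp add: norm_mult)
      qed
    qed
  qed
  have "((\<lambda>e. norm (v z * E e z)) \<longlongrightarrow> norm (v z * E 0 z)) (at_right 0)"
    unfolding E_def by (intro tendsto_intros)
  then have "norm (v z * E 0 z) \<le> K"
    by (rule tendsto_upperbound) (simp_all add: eventually_at_right_field exI[of _ 1] main del: norm_mult)
  then show ?thesis by (simp add: E_def)
qed

text \<open>
  The Borel-Caratheodory inequality on the disc of half the radius.  It is the Schwarz lemma for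
  \<open>g / (2 D - g)\<close>, where \<open>g = f - f 0\<close> has real part less than \<open>D\<close>.
\<close>
lemma borel_caratheodory_half:
  fixes f :: "complex \<Rightarrow> complex" and R A :: real
  assumes hol: "f holomorphic_on ball 0 R"
    and A: "\<And>z. norm z < R \<Longrightarrow> Re (f z) \<le> A"
    and R: "R > 0" and z: "norm z \<le> R / 2"
  shows "norm (f z - f 0) \<le> 2 * (A - Re (f 0))"
proof (rule field_le_epsilon)
  fix e :: real assume e: "e > 0"
  define D where "D = A - Re (f 0) + e / 2"
  define g where "g = (\<lambda>w. f (of_real R * w) - f 0)"
  define h where "h = (\<lambda>w. g w / (of_real (2 * D) - g w))"
  have D: "D > 0" using A[of 0] R e by (simp add: D_def)
  have inb: "norm (of_real R * w) < R" if "norm w < 1" for w :: complex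
    using that R by (simp add: norm_mult)
  have reg: "Re (g w) < D" if "norm w < 1" for w
    using A[OF inb[OF that]] e by (simp add: g_def D_def)
  have nz: "of_real (2 * D) - g w \<noteq> 0" if "norm w < 1" for w
    using reg[OF that] D by (auto simp: complex_eq_iff)
  have less: "norm (g w) < norm (of_real (2 * D) - g w)" if "norm w < 1" for w
  proof -
    have "(norm (g w))\<^sup>2 < (norm (of_real (2 * D) - g w))\<^sup>2"
      unfolding cmod_power2 using mult_strict_left_mono[OF reg[OF that], of "4 * D"] D
      by (simp add: power2_eq_square algebra_simps)
    then show ?thesis by (rule power2_less_imp_less) simp
  qed
  have "f \<circ> (\<lambda>w. of_real R * w) holomorphic_on ball 0 1"
    by (rule holomorphic_on_compose_gen[OF _ hol]) (auto intro!: holomorphic_intros inb)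
  then have hg: "g holomorphic_on ball 0 1"
    unfolding g_def o_def by (intro holomorphic_intros)
  have hh: "h holomorphic_on ball 0 1"
    unfolding h_def by (intro holomorphic_intros hg) (use nz in auto)
  define w where "w = z / of_real R"
  have w: "norm w \<le> 1/2" using z R by (simp add: w_def norm_divide field_simps)
  have "norm (h w) \<le> norm w"
  proof (rule Schwarz_Lemma(1)[OF hh])
    show "h 0 = 0" by (simp add: h_def g_def)
    show "norm (h x) < 1" if "norm x < 1" for x
      using less[OF that] nz[OF that] by (simp add: h_def norm_divide divide_less_eq)
  qed (use w in simp)
  then have hw: "norm (h w) \<le> 1/2" using w by linarith
  have "g w * (1 + h w) = of_real (2 * D) * h w"
    using nz[of w] w by (simp add: h_def field_simps)
  then have "norm (g w) * norm (1 + h w) = 2 * D * norm (h w)"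
    using D by (metis abs_of_pos mult_pos_pos norm_mult norm_of_real zero_less_numeral)
  moreover have "norm (1 + h w) \<ge> 1/2"
    using norm_triangle_ineq2[of 1 "- h w"] hw by simp
  then have "norm (g w) * (1/2) \<le> norm (g w) * norm (1 + h w)" by (intro mult_left_mono) auto
  moreover have "2 * D * norm (h w) \<le> 2 * D * (1/2)"
    using hw D by (intro mult_left_mono) auto
  ultimately have "norm (g w) \<le> 2 * D" by linarith
  then show "norm (f z - f 0) \<le> 2 * (A - Re (f 0)) + e"
    using R by (simp add: g_def w_def D_def)
qed

section \<open>Logarithms of quotients of entire functions\<close>

text \<open>
  Dividing by the Blaschke factor \<open>R (z - w) / (R\<^sup>2 - cnj w z)\<close> removes a simple zero \<open>w\<close> from the
  open disc; it leaves the modulus on the circle unchanged and does not decrease it at the centre.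
  The quotient is again entire, so the step can be repeated.
\<close>
lemma blaschke_remove_zeros:
  fixes F :: "complex \<Rightarrow> complex" and R :: real
  assumes "R > 0" "F holomorphic_on UNIV" "finite {z. norm z < R \<and> F z = 0}"
    and "\<And>z. norm z < R \<Longrightarrow> F z = 0 \<Longrightarrow> deriv F z \<noteq> 0" and "F 0 \<noteq> 0"
  shows "\<exists>F1. F1 holomorphic_on UNIV \<and> (\<forall>z. norm z < R \<longrightarrow> F1 z \<noteq> 0) \<and>
              (\<forall>z. norm z = R \<longrightarrow> norm (F1 z) = norm (F z)) \<and> norm (F 0) \<le> norm (F1 0)"
  using assms
proof (induction "card {z. norm z < R \<and> F z = 0}" arbitrary: F rule: less_induct)
  case less
  note R = less.prems(1) and hol = less.prems(2)
  show ?case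
  proof (cases "{z. norm z < R \<and> F z = 0} = {}")
    case True
    then show ?thesis using hol by (intro exI[of _ F]) auto
  next
    case False
    then obtain w where w: "norm w < R" "F w = 0" by auto
    have w0: "w \<noteq> 0" using w less.prems(5) by auto
    have d: "deriv F w \<noteq> 0" using less.prems(4) w by blast
    define Q where "Q = (\<lambda>z. if z = w then deriv F w else F z / (z - w))"
    define D where "D = (\<lambda>z. (of_real (R\<^sup>2) - cnj w * z) / of_real R)"
    define F2 where "F2 = (\<lambda>z. Q z * D z)"
    have "(\<lambda>z. if z = w then deriv F w else (F z - F w) / (z - w)) holomorphic_on UNIV"
      by (rule pole_lemma_open[OF hol]) simp
    moreover have "(\<lambda>z. if z = w then deriv F w else (F z - F w) / (z - w)) = Q"
      using w by (auto simp: Q_def)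
    ultimately have Q: "Q holomorphic_on UNIV" by simp
    have F2: "F2 holomorphic_on UNIV"
      unfolding F2_def D_def by (intro holomorphic_intros Q) (use R in auto)
    have Dnz: "D z \<noteq> 0" if "norm z < R" for z
    proof
      assume "D z = 0"
      then have "cnj w * z = of_real (R\<^sup>2)" using R by (simp add: D_def)
      then have "norm w * norm z = R\<^sup>2"
        by (metis norm_mult complex_mod_cnj norm_of_real abs_of_nonneg zero_le_power2)
      moreover have "norm w * norm z < R * R"
        using w that R by (intro mult_strict_mono') auto
      ultimately show False by (simp add: power2_eq_square)
    qed
    have zeros: "F2 z = 0 \<longleftrightarrow> F z = 0 \<and> z \<noteq> w" if "norm z < R" for z
      using Dnz[OF that] d by (auto simp: F2_def Q_def)
    have FF2: "F z * D z = F2 z * (z - w)" for z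
      using w by (auto simp: F2_def Q_def)
    have sub: "{z. norm z < R \<and> F2 z = 0} = {z. norm z < R \<and> F z = 0} - {w}"
      using zeros by auto
    have "card {z. norm z < R \<and> F2 z = 0} < card {z. norm z < R \<and> F z = 0}"
      unfolding sub using less.prems(3) w by (intro card_Diff1_less) auto
    moreover have "finite {z. norm z < R \<and> F2 z = 0}"
      unfolding sub using less.prems(3) by simp
    moreover have "deriv F2 z \<noteq> 0" if z: "norm z < R" "F2 z = 0" for z
    proof
      assume d0: "deriv F2 z = 0"
      have "(F2 has_field_derivative 0) (at z)"
        using holomorphic_derivI[OF F2, of z] d0 by simp
      then have "((\<lambda>z. F2 z * (z - w)) has_field_derivative 0) (at z)"
        by (auto intro!: derivative_eq_intros simp: z)
      then have 1: "((\<lambda>z. F z * D z) has_field_derivative 0) (at z)"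
        by (simp add: FF2)
      have Fz: "F z = 0" using zeros z by blast
      have "(F has_field_derivative deriv F z) (at z)"
        using holomorphic_derivI[OF hol, of z] by simp
      moreover have "(D has_field_derivative (- cnj w / of_real R)) (at z)"
        unfolding D_def using R by (auto intro!: derivative_eq_intros)
      ultimately have "((\<lambda>z. F z * D z) has_field_derivative deriv F z * D z) (at z)"
        by (auto intro!: derivative_eq_intros simp: Fz)
      then have "deriv F z * D z = 0" using 1 DERIV_unique by blast
      then show False using Dnz[OF z(1)] less.prems(4)[OF z(1) Fz] by simp
    qed
    moreover have "F2 0 \<noteq> 0" using zeros[of 0] R less.prems(5) by simp
    ultimately obtain F1 where F1: "F1 holomorphic_on UNIV" "\<And>z. norm z < R \<Longrightarrow> F1 z \<noteq> 0"
      "\<And>z. norm z = R \<Longrightarrow> norm (F1 z) = norm (F2 z)" "norm (F2 0) \<le> norm (F1 0)"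
      using less.hyps[of F2] R F2 by blast
    have "norm (F2 z) = norm (F z)" if z: "norm z = R" for z
    proof -
      have zw: "z \<noteq> w" using z w by auto
      have "of_real (R\<^sup>2) - cnj w * z = z * cnj (z - w)"
        using complex_norm_square[of z] z by (simp add: algebra_simps)
      then have "norm (D z) = norm (z - w)"
        using R z by (simp add: D_def norm_divide norm_mult flip: complex_cnj_diff)
      then show ?thesis using zw by (simp add: F2_def Q_def norm_mult norm_divide)
    qed
    moreover have "norm (F 0) \<le> norm (F2 0)"
    proof -
      have "norm (F2 0) = norm (F 0) * (R / norm w)"
        using w0 R by (simp add: F2_def Q_def D_def norm_mult norm_divide norm_power power2_eq_square)
      moreover have "R / norm w \<ge> 1" using w w0 by simp
      ultimately show ?thesis using mult_left_mono[of 1 "R / norm w" "norm (F 0)"] by simp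
    qed
    ultimately show ?thesis using F1 by (intro exI[of _ F1]) auto
  qed
qed

text \<open>
  A common bound \<open>M\<close> of \<open>F\<close> and \<open>exp \<phi> * F\<close> on a circle controls \<open>\<phi>\<close> on the disc of a quarter of the
  radius by a multiple of \<open>ln M\<close>, up to the values of \<open>\<phi>\<close> and \<open>F\<close> at the centre.  Once the zeros of \<open>F\<close> are removed, a first use of the Borel-Caratheodory
  inequality bounds \<open>F\<close> from below and hence \<open>Re \<phi>\<close> from above; a second one bounds \<open>\<phi>\<close>.
\<close>
lemma log_quotient_bound:
  fixes F \<phi> :: "complex \<Rightarrow> complex" and R M :: real
  assumes R: "R > 0" and F: "F holomorphic_on UNIV" and \<phi>: "\<phi> holomorphic_on UNIV"
    and simple: "\<And>z. F z = 0 \<Longrightarrow> deriv F z \<noteq> 0" and F0: "F 0 \<noteq> 0"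
    and M1: "\<And>z. norm z = R \<Longrightarrow> norm (F z) \<le> M"
    and M2: "\<And>z. norm z = R \<Longrightarrow> norm (exp (\<phi> z) * F z) \<le> M"
    and z: "norm z \<le> R / 4"
  shows "norm (\<phi> z) \<le> 3 * norm (\<phi> 0) + 6 * (ln M - ln (norm (F 0)))"
proof -
  have "finite {z. norm z < R \<and> F z = 0}"
  proof (cases "F constant_on UNIV")
    case True
    then have "{z. norm z < R \<and> F z = 0} = {}"
      using F0 by (force simp: constant_on_def)
    then show ?thesis by (metis finite.emptyI)
  next
    case False
    then have "finite {z \<in> cball 0 R. F z = 0}"
      by (intro holomorphic_compact_finite_zeros[OF F]) auto
    then show ?thesis by (rule finite_subset[rotated]) auto
  qed
  from blaschke_remove_zeros[OF R F this simple F0]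
  obtain F1 where F1: "F1 holomorphic_on UNIV" "\<And>z. norm z < R \<Longrightarrow> F1 z \<noteq> 0"
      "\<And>z. norm z = R \<Longrightarrow> norm (F1 z) = norm (F z)" "norm (F 0) \<le> norm (F1 0)"
    by blast
  have mm: "norm (H w) \<le> M" if "H holomorphic_on UNIV" "\<And>z. norm z = R \<Longrightarrow> norm (H z) \<le> M"
    "norm w \<le> R" for H w
    by (rule maximum_modulus_frontier[of H "cball 0 R"])
       (use that R in \<open>auto intro: holomorphic_on_subset holomorphic_on_imp_continuous_on continuous_on_subset\<close>)
  have b1: "norm (F1 w) \<le> M" if "norm w \<le> R" for w
    using mm[OF F1(1) _ that] F1(3) M1 by simp
  have b2: "norm (exp (\<phi> w) * F1 w) \<le> M" if "norm w \<le> R" for w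
    by (rule mm[OF _ _ that]) (use F1(3) M2 in \<open>auto intro!: holomorphic_intros F1 \<phi> simp: norm_mult\<close>)
  have "norm (F1 0) > 0" using F1(2)[of 0] R by simp
  moreover have "norm (F1 0) \<le> M" using b1[of 0] R by simp
  ultimately have M: "M > 0" by (rule less_le_trans)
  obtain l where l: "l holomorphic_on ball 0 R" "\<And>x. x \<in> ball 0 R \<Longrightarrow> exp (l x) = F1 x"
    using holomorphic_logarithm_exists[of "ball 0 R" F1 0] F1 R
    by (auto intro: holomorphic_on_subset)
  have Rel: "Re (l w) = ln (norm (F1 w))" if "norm w < R" for w
    using l(2)[of w] that by (metis ln_exp mem_ball_0 norm_exp_eq_Re)
  have Rel_le: "Re (l w) \<le> ln M" if "norm w < R" for w
    unfolding Rel[OF that] using b1[of w] F1(2)[OF that] that M by simp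
  define T where "T = ln M - ln (norm (F 0))"
  have lF0: "ln (norm (F 0)) \<le> Re (l 0)" using Rel[of 0] F1(4) F0 F1(2)[of 0] R by simp
  have re: "Re (\<phi> w) \<le> 3 * T" if w: "norm w \<le> R / 2" for w
  proof -
    have wR: "norm w < R" using w R by linarith
    have "norm (l w - l 0) \<le> 2 * (ln M - Re (l 0))"
      by (rule borel_caratheodory_half[OF l(1) Rel_le R w])
    then have "Re (l 0) - Re (l w) \<le> 2 * (ln M - Re (l 0))"
      using abs_Re_le_cmod[of "l w - l 0"] by simp
    then have 1: "- Re (l w) \<le> 2 * ln M - 3 * ln (norm (F 0))" using lF0 by argo
    have "exp (Re (\<phi> w) + Re (l w)) \<le> M"
      using b2[of w] wR l(2)[of w] by (simp add: norm_mult exp_add flip: norm_exp_eq_Re)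
    then have "Re (\<phi> w) + Re (l w) \<le> ln M" using M by (simp add: ln_ge_iff)
    then show ?thesis using 1 unfolding T_def by argo
  qed
  have "norm (\<phi> z - \<phi> 0) \<le> 2 * (3 * T - Re (\<phi> 0))"
    by (rule borel_caratheodory_half[of _ "R/2"])
       (use R z re in \<open>auto intro: holomorphic_on_subset[OF \<phi>]\<close>)
  moreover have "norm (\<phi> z) \<le> norm (\<phi> z - \<phi> 0) + norm (\<phi> 0)"
    using norm_triangle_ineq[of "\<phi> z - \<phi> 0" "\<phi> 0"] by simp
  moreover have "- Re (\<phi> 0) \<le> norm (\<phi> 0)" using abs_Re_le_cmod[of "\<phi> 0"] by simp
  ultimately show ?thesis unfolding T_def by (simp add: algebra_simps)
qed

section \<open>Growth order and hyper-order as growth bounds\<close>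

lemma le_exp_if_ln_le:
  fixes x y :: real
  assumes "x > 0" "ln x \<le> y"
  shows "x \<le> exp y"
proof -
  have "exp (ln x) \<le> exp y" using assms(2) by (subst exp_le_cancel_iff)
  then show ?thesis using assms(1) by (subst (asm) exp_ln)
qed

text \<open>
  The bound also covers functions of finite growth order, whose hyper-order is \<open>0\<close> by convention;
  this is why \<open>s\<close> must be positive.
\<close>
lemma hyper_order_less_imp_bound:
  fixes f :: "complex \<Rightarrow> complex" and s :: real
  assumes h: "hyper_order f < ereal s" and s: "s > 0"
  shows "\<exists>r. \<forall>z. norm z \<ge> r \<longrightarrow> norm (f z) \<le> exp (exp (norm z powr s))"
proof -
  have "eventually (\<lambda>z. norm (f z) \<le> exp (exp (norm z powr s))) at_infinity"
  proof (cases "growth_order f = \<infinity>")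
    case True
    then have "Limsup (inf at_infinity (principal {z. norm (f z) > exp 1}))
             (\<lambda>z. ereal (ln (ln (ln (norm (f z)))) / ln (norm z))) < ereal s"
      using h by (simp add: hyper_order_def)
    then have "eventually (\<lambda>z. norm (f z) > exp 1 \<longrightarrow> ln (ln (ln (norm (f z)))) / ln (norm z) < s) at_infinity"
      by (auto dest!: Limsup_lessD simp: eventually_inf_principal)
    moreover have "eventually (\<lambda>z::complex. norm z \<ge> 2) at_infinity"
      by (auto simp: eventually_at_infinity)
    ultimately show ?thesis
    proof eventually_elim
      case (elim z)
      have lz: "ln (norm z) > 0" using elim by (intro ln_gt_zero) linarith
      show ?case
      proof (cases "norm (f z) > exp 1")
        case True
        then have l1: "ln (norm (f z)) > 1"
          by (metis exp_gt_zero less_trans ln_exp ln_less_cancel_iff)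
        have fp: "norm (f z) > 0" using True exp_gt_zero less_trans by blast
        have "ln (ln (ln (norm (f z)))) \<le> s * ln (norm z)"
          using elim True lz by (simp add: pos_divide_less_eq[OF lz])
        then have "ln (ln (norm (f z))) \<le> exp (s * ln (norm z))"
          using l1 by (intro le_exp_if_ln_le ln_gt_zero)
        then have "ln (ln (norm (f z))) \<le> norm z powr s"
          using elim by (auto simp: powr_def)
        then have "ln (norm (f z)) \<le> exp (norm z powr s)"
          using l1 by (intro le_exp_if_ln_le) linarith+
        then show ?thesis by (rule le_exp_if_ln_le[OF fp])
      next
        case False
        then have "norm (f z) \<le> exp 1" by simp
        also have "\<dots> \<le> exp (exp (norm z powr s))" by simp
        finally show ?thesis .
      qed
    qed
  next
    case False
    then obtain t where t: "growth_order f < ereal t" using less_PInf_Ex_of_nat[of "growth_order f"] by blast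
    then have "eventually (\<lambda>z. norm (f z) > 1 \<longrightarrow> ln (ln (norm (f z))) / ln (norm z) < t) at_infinity"
      unfolding growth_order_def by (auto dest!: Limsup_lessD simp: eventually_inf_principal)
    moreover have "eventually (\<lambda>z::complex. norm z \<ge> 2) at_infinity"
      by (auto simp: eventually_at_infinity)
    moreover have "eventually (\<lambda>x::real. x powr t \<le> exp (x powr s)) at_top"
      using s by real_asymp
    then have "eventually (\<lambda>z::complex. norm z powr t \<le> exp (norm z powr s)) at_infinity"
      using filterlim_norm_at_top filterlim_iff by blast
    ultimately show ?thesis
    proof eventually_elim
      case (elim z)
      have lz: "ln (norm z) > 0" using elim by (intro ln_gt_zero) linarith
      show ?case
      proof (cases "norm (f z) > 1")
        case True
        then have l1: "ln (norm (f z)) > 0" by (rule ln_gt_zero)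
        have fp: "norm (f z) > 0" using True by linarith
        have "ln (ln (norm (f z))) \<le> t * ln (norm z)"
          using elim True lz by (simp add: pos_divide_less_eq[OF lz])
        then have "ln (norm (f z)) \<le> exp (t * ln (norm z))"
          using l1 by (intro le_exp_if_ln_le)
        then have "ln (norm (f z)) \<le> norm z powr t"
          using elim by (auto simp: powr_def)
        also have "\<dots> \<le> exp (norm z powr s)" using elim by blast
        finally show ?thesis by (rule le_exp_if_ln_le[OF fp])
      next
        case False
        then have "norm (f z) \<le> exp 0" by simp
        also have "\<dots> \<le> exp (exp (norm z powr s))" by (subst exp_le_cancel_iff) simp
        finally show ?thesis .
      qed
    qed
  qed
  then show ?thesis by (auto simp: eventually_at_infinity)
qed

lemma growth_order_le:
  fixes f :: "complex \<Rightarrow> complex" and s :: real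
  assumes "eventually (\<lambda>z. norm (f z) \<le> exp (norm z powr s)) at_infinity"
  shows "growth_order f \<le> ereal s"
  unfolding growth_order_def
proof (rule Limsup_bounded)
  have "eventually (\<lambda>z::complex. norm z \<ge> 2) at_infinity"
    by (auto simp: eventually_at_infinity)
  with assms have "eventually (\<lambda>z. norm (f z) > 1 \<longrightarrow> ln (ln (norm (f z))) / ln (norm z) \<le> s) at_infinity"
  proof eventually_elim
    case (elim z)
    have lz: "ln (norm z) > 0" using elim by (intro ln_gt_zero) linarith
    show ?case
    proof
      assume f: "norm (f z) > 1"
      then have "ln (norm (f z)) \<le> norm z powr s"
        using elim by (metis exp_gt_zero ln_exp ln_le_cancel_iff less_trans zero_less_one)
      moreover have "ln (norm (f z)) > 0" using f by (rule ln_gt_zero)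
      ultimately have "ln (ln (norm (f z))) \<le> ln (norm z powr s)" by (intro ln_mono)
      then show "ln (ln (norm (f z))) / ln (norm z) \<le> s"
        using elim unfolding pos_divide_le_eq[OF lz] by (auto simp: ln_powr)
    qed
  qed
  then show "\<forall>\<^sub>F z in inf at_infinity (principal {z. 1 < norm (f z)}).
       ereal (ln (ln (norm (f z))) / ln (norm z)) \<le> ereal s"
    by (simp add: eventually_inf_principal)
qed

lemma hyper_order_le:
  fixes f :: "complex \<Rightarrow> complex" and s :: real
  assumes "eventually (\<lambda>z. norm (f z) \<le> exp (exp (norm z powr s))) at_infinity" and "s \<ge> 0"
  shows "hyper_order f \<le> ereal s"
proof (cases "growth_order f = \<infinity>")
  case False
  then show ?thesis using assms(2) by (simp add: hyper_order_def)
next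
  case True
  have "Limsup (inf at_infinity (principal {z. norm (f z) > exp 1}))
             (\<lambda>z. ereal (ln (ln (ln (norm (f z)))) / ln (norm z))) \<le> ereal s"
  proof (rule Limsup_bounded)
    have "eventually (\<lambda>z::complex. norm z \<ge> 2) at_infinity"
      by (auto simp: eventually_at_infinity)
    with assms(1) have "eventually (\<lambda>z. norm (f z) > exp 1 \<longrightarrow>
        ln (ln (ln (norm (f z)))) / ln (norm z) \<le> s) at_infinity"
    proof eventually_elim
      case (elim z)
      have lz: "ln (norm z) > 0" using elim by (intro ln_gt_zero) linarith
      show ?case
      proof
        assume f: "norm (f z) > exp 1"
        have l: "ln (norm (f z)) > 1"
          using f by (metis exp_gt_zero less_trans ln_exp ln_less_cancel_iff)
        have "norm (f z) > 0" using f exp_gt_zero less_trans by blast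
        then have "ln (norm (f z)) \<le> exp (norm z powr s)"
          using elim by (metis exp_gt_zero ln_exp ln_le_cancel_iff)
        then have "ln (ln (norm (f z))) \<le> norm z powr s"
          using l by (metis exp_gt_zero ln_exp ln_le_cancel_iff less_trans zero_less_one)
        moreover have "ln (ln (norm (f z))) > 0" using l by (rule ln_gt_zero)
        ultimately have "ln (ln (ln (norm (f z)))) \<le> ln (norm z powr s)" by (intro ln_mono)
        then show "ln (ln (ln (norm (f z)))) / ln (norm z) \<le> s"
          using elim unfolding pos_divide_le_eq[OF lz] by (auto simp: ln_powr)
      qed
    qed
    then show "\<forall>\<^sub>F z in inf at_infinity (principal {z. exp 1 < norm (f z)}).
         ereal (ln (ln (ln (norm (f z)))) / ln (norm z)) \<le> ereal s"
      by (simp add: eventually_inf_principal)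
  qed
  then show ?thesis using True by (simp add: hyper_order_def)
qed

section \<open>The order of the exponent\<close>

lemma log_quotient_finite_order:
  fixes f \<phi> :: "complex \<Rightarrow> complex" and a :: complex
  assumes f: "f holomorphic_on UNIV" and \<phi>: "\<phi> holomorphic_on UNIV"
    and h: "hyper_order f < \<infinity>"
    and eq: "\<And>z. deriv f z - a = exp (\<phi> z) * (f z - a)"
    and simple: "\<And>z. f z = a \<Longrightarrow> deriv f z \<noteq> 0"
    and z0: "f z0 \<noteq> a"
  shows "growth_order \<phi> < \<infinity>"
proof -
  obtain s0 where s0: "hyper_order f < ereal s0"
    using h less_PInf_Ex_of_nat[of "hyper_order f"] by auto
  define s where "s = max s0 1"
  have s: "s > 0" "hyper_order f < ereal s"
    using s0 by (auto simp: s_def intro: less_le_trans)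
  obtain r where r: "\<And>z. norm z \<ge> r \<Longrightarrow> norm (f z) \<le> exp (exp (norm z powr s))"
    using hyper_order_less_imp_bound[OF s(2,1)] by blast
  define K where "K = 3 * norm (\<phi> z0) + 6 * (ln (1 + norm a) - ln (norm (f z0 - a)))"
  have main: "norm (\<phi> z) \<le> K + 6 * exp ((6 * norm z) powr s)"
    if z: "norm z \<ge> 5 * norm z0 + \<bar>r\<bar> + 1" for z
  proof -
    \<comment> \<open>The previous estimate is applied on the circle of radius \<open>4 * norm (z - z0)\<close> about \<open>z0\<close>; its
       unit neighbourhood, needed for the Cauchy estimate of \<open>deriv f\<close>, lies within \<open>6 * norm z\<close>.\<close>
    define E where "E = exp (exp ((6 * norm z) powr s))"
    have E: "E \<ge> 1" by (simp add: E_def)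
    define R where "R = 4 * norm (z - z0)"
    have zz: "norm (z - z0) \<ge> norm z - norm z0" "norm (z - z0) \<le> norm z + norm z0"
      by (simp_all add: norm_triangle_ineq2 norm_triangle_ineq4)
    have R: "R > 0" "R \<ge> norm z0 + \<bar>r\<bar> + 1" "R + norm z0 + 1 \<le> 6 * norm z"
      using z zz norm_ge_zero[of z0] unfolding R_def by linarith+
    have fb: "norm (f w) \<le> E" if "R - norm z0 - 1 \<le> norm w" "norm w \<le> R + norm z0 + 1" for w
    proof -
      have "norm (f w) \<le> exp (exp (norm w powr s))" using that R by (intro r) linarith
      also have "norm w powr s \<le> (6 * norm z) powr s"
        using that R s by (intro powr_mono2) auto
      finally show ?thesis by (simp add: E_def)
    qed
    have nw: "norm w \<le> norm (z0 + w) + norm z0" "norm (z0 + w) \<le> norm w + norm z0" for w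
      using norm_triangle_ineq[of "z0 + w" "- z0"] norm_triangle_ineq[of z0 w] by simp_all
    have F1: "norm (f (z0 + w) - a) \<le> E * (1 + norm a)" if w: "norm w = R" for w
    proof -
      have "norm (f (z0 + w) - a) \<le> norm (f (z0 + w)) + norm a" by (rule norm_triangle_ineq4)
      also have "\<dots> \<le> E + norm a" using fb[of "z0 + w"] nw[of w] w by auto
      also have "norm a \<le> E * norm a" using E mult_right_mono[of 1 E "norm a"] by simp
      finally show ?thesis by (simp add: algebra_simps)
    qed
    have F2: "norm (exp (\<phi> (z0 + w)) * (f (z0 + w) - a)) \<le> E * (1 + norm a)" if w: "norm w = R" for w
    proof -
      have "norm ((deriv ^^ 1) f (z0 + w)) \<le> fact 1 * E / 1 ^ 1"
      proof (rule Cauchy_inequality)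
        show "norm (f x) \<le> E" if x: "norm (z0 + w - x) = 1" for x
        proof (rule fb)
          show "R - norm z0 - 1 \<le> norm x" "norm x \<le> R + norm z0 + 1"
            using nw[of w] w x norm_triangle_ineq2[of "z0 + w" x] norm_triangle_ineq2[of x "z0 + w"]
            by (auto simp: norm_minus_commute)
        qed
      qed (auto intro: holomorphic_on_subset[OF f] holomorphic_on_imp_continuous_on)
      then have "norm (deriv f (z0 + w)) \<le> E" by simp
      moreover have "norm (deriv f (z0 + w) - a) \<le> norm (deriv f (z0 + w)) + norm a"
        by (rule norm_triangle_ineq4)
      moreover have "norm a \<le> E * norm a" using E mult_right_mono[of 1 E "norm a"] by simp
      ultimately show ?thesis unfolding eq[symmetric] by (simp add: algebra_simps)
    qed
    have "(f \<circ> (\<lambda>w. z0 + w)) holomorphic_on UNIV"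
      by (rule holomorphic_on_compose_gen[OF _ f]) (auto intro!: holomorphic_intros)
    then have hf: "(\<lambda>w. f (z0 + w)) holomorphic_on UNIV" by (simp add: o_def)
    have "(\<phi> \<circ> (\<lambda>w. z0 + w)) holomorphic_on UNIV"
      by (rule holomorphic_on_compose_gen[OF _ \<phi>]) (auto intro!: holomorphic_intros)
    then have h\<phi>: "(\<lambda>w. \<phi> (z0 + w)) holomorphic_on UNIV" by (simp add: o_def)
    have der: "deriv (\<lambda>w. f (z0 + w) - a) w = deriv f (z0 + w)" for w
    proof (rule DERIV_imp_deriv)
      have "(f has_field_derivative deriv f (z0 + w)) (at (z0 + w))"
        using holomorphic_derivI[OF f] by simp
      then show "((\<lambda>w. f (z0 + w) - a) has_field_derivative deriv f (z0 + w)) (at w)"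
        by (auto intro!: derivative_eq_intros DERIV_chain2[where f = f])
    qed
    have "norm (\<phi> (z0 + (z - z0))) \<le> 3 * norm (\<phi> (z0 + 0)) +
             6 * (ln (E * (1 + norm a)) - ln (norm (f (z0 + 0) - a)))"
    proof (rule log_quotient_bound[OF R(1), where F = "\<lambda>w. f (z0 + w) - a" and \<phi> = "\<lambda>w. \<phi> (z0 + w)"])
      show "norm (z - z0) \<le> R / 4" by (simp add: R_def)
    qed (use z0 F1 F2 simple der in \<open>auto intro!: holomorphic_intros hf h\<phi>\<close>)
    also have "ln (E * (1 + norm a)) = exp ((6 * norm z) powr s) + ln (1 + norm a)"
      by (subst ln_mult_pos) (auto simp: E_def add_pos_nonneg)
    finally show ?thesis by (simp add: K_def algebra_simps)
  qed
  have "eventually (\<lambda>x::real. K + 6 * exp ((6 * x) powr s) \<le> exp (x powr (s + 1))) at_top"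
    using s(1) by real_asymp
  then have "eventually (\<lambda>z::complex. K + 6 * exp ((6 * norm z) powr s) \<le> exp (norm z powr (s + 1))) at_infinity"
    using filterlim_norm_at_top filterlim_iff by blast
  moreover have "eventually (\<lambda>z::complex. norm z \<ge> 5 * norm z0 + \<bar>r\<bar> + 1) at_infinity"
    by (auto simp: eventually_at_infinity)
  ultimately have "eventually (\<lambda>z. norm (\<phi> z) \<le> exp (norm z powr (s + 1))) at_infinity"
  proof eventually_elim
    case (elim z)
    from order_trans[OF main[OF elim(2)] elim(1)] show ?case .
  qed
  then have "growth_order \<phi> \<le> ereal (s + 1)" by (rule growth_order_le)
  also have "\<dots> < \<infinity>" by simp
  finally show ?thesis .
qed

section \<open>Polynomial exponents: the upper bound for the hyper-order\<close>

lemma poly_norm_bound: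
  fixes p :: "complex poly"
  obtains C where "C > 0" "\<And>z. norm (poly p z) \<le> C * (1 + norm z) ^ degree p"
proof
  define C where "C = (\<Sum>i\<le>degree p. norm (coeff p i)) + 1"
  show "C > 0" by (simp add: C_def add_nonneg_pos sum_nonneg)
  fix z
  have "norm (poly p z) \<le> (\<Sum>i\<le>degree p. norm (coeff p i * z ^ i))"
    unfolding poly_altdef by (rule norm_sum)
  also have "\<dots> \<le> (\<Sum>i\<le>degree p. norm (coeff p i) * (1 + norm z) ^ degree p)"
  proof (rule sum_mono)
    fix i assume "i \<in> {..degree p}"
    then have "norm z ^ i \<le> (1 + norm z) ^ i" "(1 + norm z) ^ i \<le> (1 + norm z) ^ degree p"
      by (auto intro!: power_mono power_increasing)
    then show "norm (coeff p i * z ^ i) \<le> norm (coeff p i) * (1 + norm z) ^ degree p"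
      by (auto simp: norm_mult norm_power intro!: mult_left_mono)
  qed
  also have "\<dots> = (C - 1) * (1 + norm z) ^ degree p"
    by (simp add: C_def sum_distrib_right)
  also have "\<dots> \<le> C * (1 + norm z) ^ degree p"
    by (intro mult_right_mono) auto
  finally show "norm (poly p z) \<le> C * (1 + norm z) ^ degree p" .
qed

lemma hyper_order_poly_ode_le:
  fixes f :: "complex \<Rightarrow> complex" and a :: complex and p :: "complex poly"
  assumes f: "f holomorphic_on UNIV"
    and eq: "\<And>z. deriv f z - a = exp (poly p z) * (f z - a)"
  shows "hyper_order f \<le> ereal (real (degree p))"
proof (rule ccontr)
  assume "\<not> ?thesis"
  then obtain s where s: "ereal (degree p) < ereal s" "ereal s < hyper_order f"
    by (metis ereal_dense2 not_le)
  then have sn: "real (degree p) < s" by simp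
  obtain C where C: "C > 0" "\<And>z. norm (poly p z) \<le> C * (1 + norm z) ^ degree p"
    using poly_norm_bound[of p] by blast
  define n where "n = real (degree p)"
  have n: "n \<ge> 0" "n < s" using sn by (auto simp: n_def)
  define k where "k = norm (f 0 - a)"
  define l where "l = norm a"
  have kl: "k \<ge> 0" "l \<ge> 0" by (auto simp: k_def l_def)
  have main: "norm (f z) \<le> exp (norm z * exp (C * (1 + norm z) powr n)) * (k + l * norm z) + l"
    if z: "z \<noteq> 0" for z
  proof -
    define r where "r = norm z"
    define e where "e = z / of_real r"
    have r: "r > 0" using z by (simp add: r_def)
    have e: "norm e = 1" using z by (simp add: e_def r_def norm_divide)
    define B' where "B' = exp (C * (1 + r) powr n)"
    have "norm (f (of_real r * e) - a) \<le> exp (r * B') * (norm (f (of_real 0 * e) - a) + l * r)"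
    proof (rule gronwall_complex[where b = "\<lambda>t. e * exp (poly p (of_real t * e))" and c = "\<lambda>t. e * a"
            and B = "\<lambda>t. t * B'" and B' = "\<lambda>t. B'" and u = "\<lambda>t. f (of_real t * e) - a"])
      fix t assume t: "t \<in> {0..r}"
      have "((\<lambda>t. f (of_real t * e)) has_vector_derivative (e * deriv f (of_real t * e))) (at t within {0..r})"
        using has_vector_derivative_along_line[where ?z0.0 = 0 and d = e and t = t and u = f]
          holomorphic_derivI[OF f, of "of_real t * e"] by simp
      moreover have "deriv f (of_real t * e) = exp (poly p (of_real t * e)) * (f (of_real t * e) - a) + a"
        using eq[of "of_real t * e"] by (simp add: algebra_simps)
      then have "e * deriv f (of_real t * e) =
          e * exp (poly p (of_real t * e)) * (f (of_real t * e) - a) + e * a"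
        by (simp only: distrib_left mult.assoc)
      ultimately show "((\<lambda>t. f (of_real t * e) - a) has_vector_derivative
          e * exp (poly p (of_real t * e)) * (f (of_real t * e) - a) + e * a) (at t within {0..r})"
        by (simp only: has_vector_derivative_diff_const)
      show "((\<lambda>t. t * B') has_real_derivative B') (at t within {0..r})"
        by (auto intro!: derivative_eq_intros)
      have "Re (e * exp (poly p (of_real t * e))) \<le> norm (e * exp (poly p (of_real t * e)))"
        by (rule complex_Re_le_cmod)
      also have "\<dots> = exp (Re (poly p (of_real t * e)))" by (simp add: norm_mult e)
      also have "Re (poly p (of_real t * e)) \<le> C * (1 + norm (of_real t * e)) ^ degree p"
        using complex_Re_le_cmod C(2) order_trans by blast
      also have "\<dots> \<le> C * (1 + r) ^ degree p"
        using t C(1) e by (intro mult_left_mono power_mono) (auto simp: norm_mult)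
      also have "(1 + r) ^ degree p = (1 + r) powr n" using r by (simp add: n_def powr_realpow)
      finally show "Re (e * exp (poly p (of_real t * e))) \<le> B'" by (simp add: B'_def)
      show "0 \<le> t * B'" using t by (simp add: B'_def)
      show "norm (e * a) \<le> l" by (simp add: norm_mult e l_def)
    qed (use r in auto)
    moreover have "of_real r * e = z" using r by (simp add: e_def)
    moreover have "norm (f z) \<le> norm (f z - a) + l"
      using norm_triangle_ineq[of "f z - a" a] by (simp add: l_def)
    ultimately show ?thesis by (simp add: B'_def r_def k_def)
  qed
  define s' where "s' = (n + s) / 2"
  have ss: "n < s'" "s' < s" "0 < s'" using n by (auto simp: s'_def)
  have "eventually (\<lambda>x::real. C * (1 + x) powr n \<le> x powr s' / 2) at_top"
    using C(1) ss n by real_asymp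
  moreover have "eventually (\<lambda>x::real. x * exp (x powr s' / 2) \<le> exp (x powr s')) at_top"
    using ss by real_asymp
  moreover have "eventually (\<lambda>x::real. exp (exp (x powr s')) * (k + l * x) + l \<le> exp (exp (x powr s))) at_top"
    using ss kl by real_asymp
  moreover have "eventually (\<lambda>x::real. x \<ge> 1) at_top" by (rule eventually_ge_at_top)
  ultimately have "eventually (\<lambda>x::real. exp (x * exp (C * (1 + x) powr n)) * (k + l * x) + l
      \<le> exp (exp (x powr s))) at_top"
  proof eventually_elim
    case (elim x)
    have "x * exp (C * (1 + x) powr n) \<le> x * exp (x powr s' / 2)"
      using elim by (intro mult_left_mono) auto
    then have "x * exp (C * (1 + x) powr n) \<le> exp (x powr s')" using elim by linarith
    then have "exp (x * exp (C * (1 + x) powr n)) * (k + l * x) \<le> exp (exp (x powr s')) * (k + l * x)"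
      using elim kl by (intro mult_right_mono) auto
    then show ?case using elim by linarith
  qed
  then have "eventually (\<lambda>z::complex. exp (norm z * exp (C * (1 + norm z) powr n)) * (k + l * norm z) + l
      \<le> exp (exp (norm z powr s))) at_infinity"
    using filterlim_norm_at_top filterlim_iff by blast
  moreover have "eventually (\<lambda>z::complex. norm z \<ge> 1) at_infinity"
    by (auto simp: eventually_at_infinity)
  ultimately have "eventually (\<lambda>z. norm (f z) \<le> exp (exp (norm z powr s))) at_infinity"
  proof eventually_elim
    case (elim z)
    then have "z \<noteq> 0" by auto
    from order_trans[OF main[OF this] elim(1)] show ?case .
  qed
  then have "hyper_order f \<le> ereal s" using n by (intro hyper_order_le) auto
  then show False using s by simp
qed

section \<open>The differential equation in a half-plane\<close>

text \<open>
  In the chart \<open>p z = \<sigma> \<zeta>\<close>, where \<open>\<sigma>\<close> is \<open>1\<close> or \<open>-1\<close> and \<open>Re \<zeta> \<ge> 0\<close>, the equation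
  \<open>F' = exp p * F + a\<close> becomes \<open>u' = (exp (\<sigma> \<zeta>) u + a) k\<close>, where \<open>k\<close> is the derivative of the inverse
  of the chart.  The case \<open>\<sigma> = -1\<close> comes first: any point of large modulus is reached from a fixed point of the real
  axis by a path on which the integral of \<open>exp (- Re \<zeta>)\<close> is bounded independently of the point.
\<close>
lemma decaying_ode_linear_bound:
  fixes u k :: "complex \<Rightarrow> complex" and a :: complex and M R :: real
  assumes R: "R \<ge> 1"
    and u: "\<And>z. Re z \<ge> 0 \<Longrightarrow> norm z \<ge> R \<Longrightarrow>
              (u has_field_derivative (exp (- z) * u z + a) * k z) (at z)"
    and k: "\<And>z. Re z \<ge> 0 \<Longrightarrow> norm z \<ge> R \<Longrightarrow> norm (k z) \<le> M"
  obtains C where "\<And>z. Re z \<ge> 0 \<Longrightarrow> norm z \<ge> 2 * R \<Longrightarrow> norm (u z) \<le> C * norm z"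
proof
  define m where "m = norm a * M"
  have M: "M \<ge> 0" using order_trans[OF norm_ge_zero k[of "of_real R"]] R by simp
  have m: "m \<ge> 0" using M by (simp add: m_def)
  define C where "C = exp (3 * M) * (norm (u (of_real R)) + 4 * m)"
  fix z assume z: "Re z \<ge> 0" "norm z \<ge> 2 * R"
  define x1 where "x1 = Re z + \<bar>Im z\<bar>"
  have x1: "x1 \<ge> 2 * R" "x1 \<le> 2 * norm z"
    using z cmod_le[of z] abs_Re_le_cmod[of z] abs_Im_le_cmod[of z] by (auto simp: x1_def)
  have mz: "norm (a * k w) \<le> m" if "Re w \<ge> 0" "norm w \<ge> R" for w
    unfolding m_def norm_mult using k[OF that] by (intro mult_left_mono) auto
  \<comment> \<open>The path runs along the real axis from \<open>R\<close> to \<open>x1\<close> and then diagonally to \<open>z\<close>; on the diagonal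
     \<open>Re w + \<bar>Im w\<bar>\<close> is constantly \<open>x1\<close>, which keeps the path outside the disc of radius \<open>R\<close>.\<close>
  have "norm (u (of_real R + of_real (x1 - R) * 1)) \<le>
          exp (M * (1 - exp (- (x1 - R)))) * (norm (u (of_real R + of_real 0 * 1)) + m * (x1 - R))"
  proof (rule gronwall_complex[where u = "\<lambda>t. u (of_real R + of_real t * 1)"
        and b = "\<lambda>t. exp (- (of_real R + of_real t)) * k (of_real R + of_real t)"
        and c = "\<lambda>t. a * k (of_real R + of_real t)"
        and B = "\<lambda>t. M * (1 - exp (- t))" and B' = "\<lambda>t. M * exp (- t)"])
    fix t assume t: "t \<in> {0..x1 - R}"
    define w :: complex where "w = of_real R + of_real t"
    have w: "Re w \<ge> 0" "norm w \<ge> R"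
      using t R by (auto simp: w_def simp flip: of_real_add)
    have "((\<lambda>t. u (of_real R + of_real t * 1)) has_vector_derivative
             1 * ((exp (- w) * u w + a) * k w)) (at t within {0..x1 - R})"
      by (rule has_vector_derivative_along_line) (use u[OF w] in \<open>simp add: w_def\<close>)
    then show "((\<lambda>t. u (of_real R + of_real t * 1)) has_vector_derivative
       exp (- (of_real R + of_real t)) * k (of_real R + of_real t) * u (of_real R + of_real t * 1) +
       a * k (of_real R + of_real t)) (at t within {0..x1 - R})"
      by (simp add: w_def algebra_simps)
    show "((\<lambda>t. M * (1 - exp (- t))) has_real_derivative M * exp (- t)) (at t within {0..x1 - R})"
      by (auto intro!: derivative_eq_intros)
    have "Re (exp (- w) * k w) \<le> norm (exp (- w)) * norm (k w)"
      using complex_Re_le_cmod norm_mult by metis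
    also have "\<dots> \<le> exp (- t) * M"
      using k[OF w] R by (intro mult_mono) (auto simp: w_def)
    finally show "Re (exp (- (of_real R + of_real t)) * k (of_real R + of_real t)) \<le> M * exp (- t)"
      by (simp add: w_def mult.commute)
    show "0 \<le> M * (1 - exp (- t))" using M t by simp
    show "norm (a * k (of_real R + of_real t)) \<le> m" using mz[OF w] by (simp add: w_def)
  qed (use x1 R in auto)
  moreover have "exp (M * (1 - exp (- (x1 - R)))) \<le> exp M"
    using M by (simp add: mult_left_le)
  then have "exp (M * (1 - exp (- (x1 - R)))) * (norm (u (of_real R)) + m * (x1 - R))
      \<le> exp M * (norm (u (of_real R)) + m * x1)"
    using m x1 R by (intro mult_mono add_mono mult_left_mono) auto
  ultimately have step1: "norm (u (of_real x1)) \<le> exp M * (norm (u (of_real R)) + m * x1)"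
    by simp
  define d where "d = Complex (- 1) (sgn (Im z))"
  have d: "norm d \<le> 2" using cmod_le[of d] by (auto simp: d_def sgn_if)
  have "norm (u (of_real x1 + of_real \<bar>Im z\<bar> * d)) \<le>
          exp (2 * M * exp (- (x1 - \<bar>Im z\<bar>))) * (norm (u (of_real x1 + of_real 0 * d)) + 2 * m * \<bar>Im z\<bar>)"
  proof (rule gronwall_complex[where u = "\<lambda>t. u (of_real x1 + of_real t * d)"
        and b = "\<lambda>t. d * (exp (- (of_real x1 + of_real t * d)) * k (of_real x1 + of_real t * d))"
        and c = "\<lambda>t. d * (a * k (of_real x1 + of_real t * d))"
        and B = "\<lambda>t. 2 * M * exp (- (x1 - t))" and B' = "\<lambda>t. 2 * M * exp (- (x1 - t))"])
    fix t assume t: "t \<in> {0..\<bar>Im z\<bar>}"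
    define w :: complex where "w = of_real x1 + of_real t * d"
    have Rew: "Re w = x1 - t" by (simp add: w_def d_def)
    have "Re w + \<bar>Im w\<bar> \<ge> 2 * R" using t x1 by (auto simp: w_def d_def abs_mult sgn_if)
    moreover have "Re w + \<bar>Im w\<bar> \<le> 2 * norm w"
      using abs_Re_le_cmod[of w] abs_Im_le_cmod[of w] by linarith
    ultimately have w: "Re w \<ge> 0" "norm w \<ge> R"
      using t z by (auto simp: Rew x1_def)
    have "((\<lambda>t. u (of_real x1 + of_real t * d)) has_vector_derivative
             d * ((exp (- w) * u w + a) * k w)) (at t within {0..\<bar>Im z\<bar>})"
      by (rule has_vector_derivative_along_line) (use u[OF w] in \<open>simp add: w_def\<close>)
    then show "((\<lambda>t. u (of_real x1 + of_real t * d)) has_vector_derivative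
       d * (exp (- (of_real x1 + of_real t * d)) * k (of_real x1 + of_real t * d)) * u (of_real x1 + of_real t * d) +
       d * (a * k (of_real x1 + of_real t * d))) (at t within {0..\<bar>Im z\<bar>})"
      unfolding w_def[symmetric] by (simp add: algebra_simps)
    show "((\<lambda>t. 2 * M * exp (- (x1 - t))) has_real_derivative 2 * M * exp (- (x1 - t))) (at t within {0..\<bar>Im z\<bar>})"
      by (auto intro!: derivative_eq_intros)
    have "Re (d * (exp (- w) * k w)) \<le> norm d * (norm (exp (- w)) * norm (k w))"
      using complex_Re_le_cmod norm_mult by metis
    also have "\<dots> \<le> 2 * (exp (- (x1 - t)) * M)"
      using k[OF w] d by (intro mult_mono) (auto simp: Rew)
    finally show "Re (d * (exp (- (of_real x1 + of_real t * d)) * k (of_real x1 + of_real t * d)))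
                   \<le> 2 * M * exp (- (x1 - t))"
      unfolding w_def[symmetric] by (simp only: mult_ac)
    show "0 \<le> 2 * M * exp (- (x1 - t))" using M by simp
    have "norm (d * (a * k w)) \<le> 2 * m"
      unfolding norm_mult[of d] using mz[OF w] d by (intro mult_mono) auto
    then show "norm (d * (a * k (of_real x1 + of_real t * d))) \<le> 2 * m" by (simp add: w_def)
  qed auto
  moreover have "of_real x1 + of_real \<bar>Im z\<bar> * d = z"
    by (auto simp: complex_eq_iff x1_def d_def sgn_if)
  moreover have "2 * M * exp (- (x1 - \<bar>Im z\<bar>)) \<le> 2 * M * 1"
    using z M by (intro mult_left_mono) (auto simp: x1_def)
  then have "exp (2 * M * exp (- (x1 - \<bar>Im z\<bar>))) * (norm (u (of_real x1)) + 2 * m * \<bar>Im z\<bar>)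
     \<le> exp (2 * M) * (norm (u (of_real x1)) + 2 * m * norm z)"
    using m abs_Im_le_cmod[of z] by (intro mult_mono add_mono mult_left_mono) auto
  ultimately have "norm (u z) \<le> exp (2 * M) * (norm (u (of_real x1)) + 2 * m * norm z)" by simp
  also have "norm (u (of_real x1)) \<le> exp M * (norm (u (of_real R)) + m * (2 * norm z))"
    by (rule order_trans[OF step1]) (use x1 m in \<open>auto intro!: mult_left_mono\<close>)
  also have "2 * m * norm z \<le> exp M * (2 * m * norm z)"
    using M m mult_right_mono[of 1 "exp M" "2 * m * norm z"] by simp
  also have "norm (u (of_real R)) \<le> norm (u (of_real R)) * norm z"
    using z R mult_left_mono[of 1 "norm z" "norm (u (of_real R))"] by simp
  finally have "norm (u z) \<le> exp (2 * M) * (exp M * (norm (u (of_real R)) * norm z + m * (2 * norm z)) +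
       exp M * (2 * m * norm z))" by simp
  also have "\<dots> = C * norm z"
  proof -
    have "exp (3 * M) = exp (2 * M) * exp M" by (simp flip: exp_add)
    then show ?thesis by (simp add: C_def algebra_simps)
  qed
  finally show "norm (u z) \<le> C * norm z" .
qed

text \<open>
  For \<open>k z = \<kappa> (1 + e) z\<^sup>-\<^sup>\<beta>\<close> with small \<open>e\<close>, the argument of \<open>exp z * k z\<close> on a horizontal line is
  \<open>Im z + Im (Ln \<kappa>) - \<beta> Im (Ln z)\<close> up to the small contribution of \<open>1 + e\<close>.  Along the line
  \<open>\<beta> Im (Ln z)\<close> stays between \<open>0\<close> and \<open>pi / 2\<close>, or between \<open>- pi / 2\<close> and \<open>0\<close>.  The heights are chosen
  so that the argument stays within \<open>pi / 4\<close> of \<open>pi\<close>, again up to \<open>1 + e\<close>.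
\<close>
lemma good_line:
  fixes \<kappa> e z :: complex and \<beta> s :: real and j :: int
  assumes \<kappa>: "\<kappa> \<noteq> 0" and e: "norm e \<le> 1/4" and \<beta>: "0 \<le> \<beta>" "\<beta> \<le> 1"
    and z: "Re z \<ge> 0"
    and line: "Im z > 0 \<and> Im z = 5 * pi / 4 - Im (Ln \<kappa>) + 2 * pi * of_int j \<or>
               Im z < 0 \<and> Im z = 3 * pi / 4 - Im (Ln \<kappa>) + 2 * pi * of_int j"
  shows "Re (exp z * (\<kappa> * (1 + e) * exp (- of_real \<beta> * Ln z))) \<le> 0"
proof -
  have z0: "z \<noteq> 0" using line by auto
  define L where "L = Im (Ln z)"
  have L: "\<bar>L\<bar> \<le> pi / 2" using Re_Ln_pos_le[OF z0] z by (simp add: L_def)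
  obtain \<theta> where \<theta>: "\<bar>\<theta>\<bar> \<le> pi / 4" and eq: "Im z + Im (Ln \<kappa>) - \<beta> * L = \<theta> + pi + 2 * pi * of_int j"
  proof (cases "Im z > 0")
    case True
    then have "0 \<le> L" using Im_Ln_pos_le[OF z0] by (simp add: L_def)
    then have "0 \<le> \<beta> * L" "\<beta> * L \<le> 1 * (pi / 2)"
      using \<beta> L mult_mono[of \<beta> 1 L "pi / 2"] by auto
    then have "\<bar>pi / 4 - \<beta> * L\<bar> \<le> pi / 4" by linarith
    then show ?thesis using line True by (intro that[of "pi / 4 - \<beta> * L"]) auto
  next
    case False
    then have "Im z < 0" using line by auto
    then have "L \<le> 0" using Im_Ln_pos_le[OF z0] Im_Ln_le_pi[OF z0] by (auto simp: L_def)
    then have "0 \<le> \<beta> * (- L)" "\<beta> * (- L) \<le> 1 * (pi / 2)"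
      using \<beta> L mult_mono[of \<beta> 1 "- L" "pi / 2"] by (auto simp: mult_nonneg_nonpos)
    then have "\<bar>- pi / 4 - \<beta> * L\<bar> \<le> pi / 4"
      unfolding mult_minus_right abs_le_iff by linarith
    then show ?thesis using line False by (intro that[of "- pi / 4 - \<beta> * L"]) auto
  qed
  define w where "w = z + Ln \<kappa> - of_real \<beta> * Ln z"
  have "exp z * (\<kappa> * (1 + e) * exp (- of_real \<beta> * Ln z)) = exp w * (1 + e)"
    using \<kappa> by (simp add: w_def exp_add exp_diff exp_minus divide_inverse)
  also have "w = of_real (Re w) + \<i> * of_real (\<theta> + pi + 2 * pi * of_int j)"
    using eq by (simp add: complex_eq_iff w_def L_def)
  also have "exp \<dots> = - (of_real (exp (Re w)) * exp (\<i> * of_real \<theta>))"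
  proof -
    have 1: "\<i> * of_real (\<theta> + pi + 2 * pi * of_int j) =
        \<i> * complex_of_real \<theta> + \<i> * of_real pi + 2 * of_int j * of_real pi * \<i>"
      by (simp add: algebra_simps)
    have 2: "exp (2 * of_int j * of_real pi * \<i>) = (1::complex)"
      using exp_integer_2pi[of "of_int j"] by (simp add: mult_ac)
    have "exp (\<i> * of_real (\<theta> + pi + 2 * pi * of_int j)) = - exp (\<i> * complex_of_real \<theta>)"
      unfolding 1 exp_add 2 by (simp add: exp_pi_i')
    then show ?thesis unfolding exp_add[of "of_real (Re w)"] by (simp add: exp_of_real)
  qed
  finally have "exp z * (\<kappa> * (1 + e) * exp (- of_real \<beta> * Ln z)) =
      - (of_real (exp (Re w)) * (exp (\<i> * of_real \<theta>) * (1 + e)))"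
    by (simp only: mult_minus_left mult.assoc)
  moreover have "Re (- (of_real (exp (Re w)) * q)) = - (exp (Re w) * Re q)" for q
    by simp
  ultimately have "Re (exp z * (\<kappa> * (1 + e) * exp (- of_real \<beta> * Ln z))) =
      - (exp (Re w) * Re (exp (\<i> * of_real \<theta>) * (1 + e)))"
    by (simp only:)
  moreover have "Re (exp (\<i> * of_real \<theta>) * (1 + e)) \<ge> 0"
  proof -
    have "Re (exp (\<i> * of_real \<theta>) * (1 + e)) = cos \<theta> + Re (exp (\<i> * of_real \<theta>) * e)"
      by (simp add: distrib_left Re_exp)
    moreover have "\<bar>Re (exp (\<i> * of_real \<theta>) * e)\<bar> \<le> norm (exp (\<i> * of_real \<theta>) * e)"
      by (rule abs_Re_le_cmod)
    then have "\<bar>Re (exp (\<i> * of_real \<theta>) * e)\<bar> \<le> 1/4" using e by (simp add: norm_mult)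
    moreover have "cos (pi / 4) \<le> cos \<bar>\<theta>\<bar>"
      using \<theta> pi_gt_zero by (intro cos_monotone_0_pi_le) auto
    then have "sqrt 2 / 2 \<le> cos \<theta>" by (simp add: cos_45)
    moreover have "sqrt 2 \<ge> 1" by simp
    ultimately show ?thesis by linarith
  qed
  ultimately show ?thesis by simp
qed

text \<open>
  The case \<open>\<sigma> = 1\<close>, with the linear bound on the imaginary axis, which is the boundary of the
  neighbouring half-planes with \<open>\<sigma> = -1\<close>, as a hypothesis.  The function \<open>e\<close> is the relative error
  in the asymptotic form \<open>\<kappa> z\<^sup>-\<^sup>\<beta>\<close> of \<open>k\<close>.
\<close>
locale right_half_plane_ode =
  fixes u k e :: "complex \<Rightarrow> complex" and a \<kappa> :: complex and M R \<beta> C :: real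
  assumes R: "R \<ge> 1"
    and u: "\<And>z. Re z \<ge> 0 \<Longrightarrow> norm z \<ge> R \<Longrightarrow>
              (u has_field_derivative (exp z * u z + a) * k z) (at z)"
    and k: "\<And>z. Re z \<ge> 0 \<Longrightarrow> norm z \<ge> R \<Longrightarrow> norm (k z) \<le> M"
    and k_eq: "\<And>z. Re z \<ge> 0 \<Longrightarrow> norm z \<ge> R \<Longrightarrow> k z = \<kappa> * (1 + e z) * exp (- of_real \<beta> * Ln z)"
    and e: "\<And>z. Re z \<ge> 0 \<Longrightarrow> norm z \<ge> R \<Longrightarrow> norm (e z) \<le> 1/4"
    and \<kappa>: "\<kappa> \<noteq> 0" and \<beta>: "0 \<le> \<beta>" "\<beta> \<le> 1" and C: "C \<ge> 0"
    and growth: "\<And>d. d > 0 \<Longrightarrow> \<exists>X. \<forall>z. Re z \<ge> 0 \<and> norm z \<ge> X \<longrightarrow> norm (u z) \<le> exp (exp (d * norm z))"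
    and axis: "\<And>z. Re z = 0 \<Longrightarrow> norm z \<ge> R \<Longrightarrow> norm (u z) \<le> C * norm z"
begin

lemma M_nonneg: "M \<ge> 0"
  using order_trans[OF norm_ge_zero k[of "of_real R"]] R by simp

text \<open>
  On a horizontal ray on which \<open>exp z * k z\<close> has nonpositive real part, the homogeneous part of the
  equation does not increase the modulus of \<open>u\<close>, and the inhomogeneous part contributes linearly.
\<close>
lemma side_bound:
  assumes x0: "x0 \<ge> 0" and D: "D \<ge> 0"
    and dom: "\<And>z. Re z \<ge> x0 \<Longrightarrow> Im z = y \<Longrightarrow> norm z \<ge> R"
    and neg: "\<And>z. Re z \<ge> x0 \<Longrightarrow> Im z = y \<Longrightarrow> Re (exp z * k z) \<le> 0"
    and start: "norm (u (Complex x0 y)) \<le> D * norm (Complex x0 y)"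
    and z: "Re z \<ge> x0" "Im z = y"
  shows "norm (u z) \<le> (D + norm a * M) * norm z"
proof -
  define z0 where "z0 = Complex x0 y"
  have "norm (u (z0 + of_real (Re z - x0) * 1)) \<le> exp 0 * (norm (u (z0 + of_real 0 * 1)) + norm a * M * (Re z - x0))"
  proof (rule gronwall_complex[where u = "\<lambda>t. u (z0 + of_real t * 1)"
        and b = "\<lambda>t. exp (z0 + of_real t) * k (z0 + of_real t)"
        and c = "\<lambda>t. a * k (z0 + of_real t)" and B = "\<lambda>t. 0" and B' = "\<lambda>t. 0"])
    fix t assume t: "t \<in> {0..Re z - x0}"
    define w where "w = z0 + of_real t"
    have w': "Re w \<ge> x0" "Im w = y" using t by (auto simp: w_def z0_def)
    have w: "Re w \<ge> 0" "norm w \<ge> R" using dom[OF w'] w' x0 by auto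
    have "((\<lambda>t. u (z0 + of_real t * 1)) has_vector_derivative
             1 * ((exp w * u w + a) * k w)) (at t within {0..Re z - x0})"
      by (rule has_vector_derivative_along_line) (use u[OF w] in \<open>simp add: w_def\<close>)
    then show "((\<lambda>t. u (z0 + of_real t * 1)) has_vector_derivative
       exp (z0 + of_real t) * k (z0 + of_real t) * u (z0 + of_real t * 1) +
       a * k (z0 + of_real t)) (at t within {0..Re z - x0})"
      by (simp add: w_def algebra_simps)
    show "Re (exp (z0 + of_real t) * k (z0 + of_real t)) \<le> 0"
      using neg[OF w'] by (simp add: w_def)
    show "norm (a * k (z0 + of_real t)) \<le> norm a * M"
      using k[OF w] by (auto simp: w_def norm_mult intro!: mult_left_mono)
  qed (use z in auto)
  moreover have "z0 + of_real (Re z - x0) * 1 = z" using z by (simp add: z0_def complex_eq_iff)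
  ultimately have "norm (u z) \<le> norm (u z0) + norm a * M * (Re z - x0)" by simp
  moreover have "norm (u z0) \<le> D * norm z0" using start by (simp add: z0_def)
  moreover have "norm z0 \<le> norm z"
    using z x0 by (auto simp: z0_def cmod_def intro!: real_sqrt_le_mono power_mono)
  then have "D * norm z0 \<le> D * norm z" using D by (rule mult_left_mono)
  moreover have "Re z - x0 \<le> norm z" using complex_Re_le_cmod[of z] x0 by linarith
  then have "norm a * M * (Re z - x0) \<le> norm a * M * norm z"
    using M_nonneg by (intro mult_left_mono) auto
  ultimately show ?thesis unfolding distrib_right by linarith
qed

lemma strip_bound:
  assumes x0: "x0 \<ge> 0" and D: "D \<ge> 0" and y: "y1 < y2"
    and dom: "\<And>z. Re z \<ge> x0 \<Longrightarrow> y1 \<le> Im z \<Longrightarrow> Im z \<le> y2 \<Longrightarrow> norm z \<ge> R"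
    and neg: "\<And>z. Re z \<ge> x0 \<Longrightarrow> Im z = y1 \<or> Im z = y2 \<Longrightarrow> Re (exp z * k z) \<le> 0"
    and left: "\<And>z. Re z = x0 \<Longrightarrow> y1 \<le> Im z \<Longrightarrow> Im z \<le> y2 \<Longrightarrow> norm (u z) \<le> D * norm z"
    and z: "Re z \<ge> x0" "y1 \<le> Im z" "Im z \<le> y2"
  shows "norm (u z) \<le> (D + norm a * M + 1) * norm z"
proof -
  define K where "K = D + norm a * M + 1"
  have aM: "norm a * M \<ge> 0" using M_nonneg by simp
  have K: "K > 0" using D aM by (simp add: K_def)
  have diff: "(u has_field_derivative (exp w * u w + a) * k w) (at w)" and nz: "w \<noteq> 0" and n1: "norm w \<ge> 1"
    if "Re w \<ge> x0" "y1 \<le> Im w" "Im w \<le> y2" for w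
    using u[of w] dom[OF that] that x0 R by auto
  have divK: "norm (u w / w) \<le> K" if "norm (u w) \<le> D' * norm w" "D' \<le> K" "w \<noteq> 0" for w D'
  proof -
    have "norm (u w) \<le> K * norm w"
      using that(1) mult_right_mono[OF that(2), of "norm w"] by simp
    then show ?thesis using that(3) by (simp add: norm_divide divide_le_eq)
  qed
  have cont: "continuous_on {z. Re z \<ge> x0 \<and> y1 \<le> Im z \<and> Im z \<le> y2} (\<lambda>w. u w / w)"
  proof (intro continuous_at_imp_continuous_on ballI)
    fix w assume "w \<in> {z. Re z \<ge> x0 \<and> y1 \<le> Im z \<and> Im z \<le> y2}"
    then have w: "Re w \<ge> x0" "y1 \<le> Im w" "Im w \<le> y2" by auto
    show "isCont (\<lambda>w. u w / w) w"
      using DERIV_isCont[OF diff[OF w]] nz[OF w] by (intro isCont_divide continuous_ident)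
  qed
  have "norm (u z / z) \<le> K"
  proof (rule phragmen_lindelof_half_strip[OF y K _ cont _ _ _ z])
    show "(\<lambda>w. u w / w) holomorphic_on {z. x0 < Re z \<and> y1 < Im z \<and> Im z < y2}"
    proof (rule holomorphic_onI)
      fix w assume w: "w \<in> {z. x0 < Re z \<and> y1 < Im z \<and> Im z < y2}"
      then have w': "Re w \<ge> x0" "y1 \<le> Im w" "Im w \<le> y2" by auto
      have "u field_differentiable (at w)" "w \<noteq> 0"
        using diff[OF w'] nz[OF w'] unfolding field_differentiable_def by blast+
      then show "(\<lambda>w. u w / w) field_differentiable (at w within {z. x0 < Re z \<and> y1 < Im z \<and> Im z < y2})"
        by (intro field_differentiable_at_within[OF field_differentiable_divide]) auto
    qed
  next
    fix w assume "Re w = x0" "y1 \<le> Im w" "Im w \<le> y2"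
    then show "norm (u w / w) \<le> K"
      using left[of w] nz[of w] aM x0 by (intro divK[of w D]) (auto simp: K_def)
  next
    fix w assume w: "x0 \<le> Re w" "Im w = y1 \<or> Im w = y2"
    have "norm (u w) \<le> (D + norm a * M) * norm w"
    proof (rule side_bound[OF x0 D])
      show "norm z \<ge> R" if "x0 \<le> Re z" "Im z = Im w" for z using dom that w y by auto
      show "Re (exp z * k z) \<le> 0" if "x0 \<le> Re z" "Im z = Im w" for z using neg that w by auto
      show "norm (u (Complex x0 (Im w))) \<le> D * norm (Complex x0 (Im w))"
        using left[of "Complex x0 (Im w)"] w y by auto
    qed (use w in auto)
    then show "norm (u w / w) \<le> K"
      using nz[of w] w y by (intro divK[of w "D + norm a * M"]) (auto simp: K_def)
  next
    fix d :: real assume d: "d > 0"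
    obtain X where X: "\<And>w. Re w \<ge> 0 \<Longrightarrow> norm w \<ge> X \<Longrightarrow> norm (u w) \<le> exp (exp (d / 2 * norm w))"
      using growth[of "d / 2"] d by auto
    define X' where "X' = max x0 (max X (\<bar>y1\<bar> + \<bar>y2\<bar>))"
    show "\<exists>X. \<forall>z. X \<le> Re z \<and> y1 \<le> Im z \<and> Im z \<le> y2 \<longrightarrow> norm (u z / z) \<le> exp (exp (d * Re z))"
    proof (intro exI[of _ X'] allI impI)
      fix w assume w: "X' \<le> Re w \<and> y1 \<le> Im w \<and> Im w \<le> y2"
      then have w': "x0 \<le> Re w" "X \<le> Re w" "\<bar>y1\<bar> + \<bar>y2\<bar> \<le> Re w" by (auto simp: X'_def)
      have "norm w \<le> 2 * Re w" using cmod_le[of w] w w' x0 by linarith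
      then have "d / 2 * norm w \<le> d / 2 * (2 * Re w)" using d by (intro mult_left_mono) auto
      then have 1: "exp (exp (d / 2 * norm w)) \<le> exp (exp (d * Re w))" by simp
      have "norm (u w) \<le> exp (exp (d / 2 * norm w))"
        using w' x0 complex_Re_le_cmod[of w] by (intro X) linarith+
      moreover have "norm (u w / w) \<le> norm (u w)"
        using n1[of w] w w' by (simp add: norm_divide divide_le_eq mult_le_cancel_left1)
      ultimately show "norm (u w / w) \<le> exp (exp (d * Re w))" using 1 by linarith
    qed
  qed
  then show ?thesis using nz[OF z] by (simp add: K_def norm_divide divide_le_eq)
qed

lemma neg_on_line:
  assumes "Re z \<ge> 0" "norm z \<ge> R"
    "Im z > 0 \<and> Im z = 5 * pi / 4 - Im (Ln \<kappa>) + 2 * pi * of_int j \<or>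
     Im z < 0 \<and> Im z = 3 * pi / 4 - Im (Ln \<kappa>) + 2 * pi * of_int j"
  shows "Re (exp z * k z) \<le> 0"
  using good_line[OF \<kappa> e[OF assms(1,2)] \<beta> assms(1,3)] k_eq[OF assms(1,2)] by simp

text \<open>
  The lines of nonpositivity at distance more than \<open>R\<close> from the real axis divide the half-plane into
  strips of width \<open>2 * pi\<close> and one strip around the real axis.  The latter meets the disc of radius
  \<open>R\<close>, so that it is cut off at \<open>Re z = R\<close>, where \<open>u\<close> is bounded by compactness.
\<close>
lemma linear_bound:
  obtains C' R' where "\<And>z. Re z \<ge> 0 \<Longrightarrow> norm z \<ge> R' \<Longrightarrow> norm (u z) \<le> C' * norm z"
proof -
  define g where "g = Im (Ln \<kappa>)"
  obtain N1 :: int where N1: "(R + g - 5 * pi / 4) / (2 * pi) < of_int N1" using ex_less_of_int by blast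
  obtain N2 :: int where N2: "(R - g + 3 * pi / 4) / (2 * pi) < of_int N2" using ex_less_of_int by blast
  define yp where "yp = (\<lambda>j::int. 5 * pi / 4 - g + 2 * pi * of_int j)"
  define yn where "yn = (\<lambda>j::int. 3 * pi / 4 - g + 2 * pi * of_int j)"
  have yp: "yp N1 > R" using N1 by (simp add: yp_def divide_less_eq algebra_simps)
  have yn: "yn (- N2) < - R" using N2 by (simp add: yn_def divide_less_eq algebra_simps)
  have y_less: "yn (- N2) < yp N1" using yp yn R by linarith
  define S where "S = cbox (Complex R (yn (- N2))) (Complex R (yp N1))"
  have "continuous_on S u"
  proof (intro continuous_at_imp_continuous_on ballI)
    fix z assume "z \<in> S"
    then have "Re z \<ge> R" by (auto simp: S_def in_cbox_complex_iff)
    then show "isCont u z" using u[of z] R complex_Re_le_cmod[of z] by (auto intro: DERIV_isCont)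
  qed
  then have "bounded (u ` S)"
    by (intro compact_imp_bounded compact_continuous_image) (auto simp: S_def)
  then obtain B where B: "B > 0" "\<And>z. z \<in> S \<Longrightarrow> norm (u z) \<le> B"
    by (auto simp: bounded_pos)
  define C' where "C' = max B C + norm a * M + 1"
  have mono: "norm (u z) \<le> C' * norm z" if "norm (u z) \<le> (D + norm a * M + 1) * norm z" "D \<le> max B C" for z D
    by (rule order_trans[OF that(1)]) (use that in \<open>auto simp: C'_def intro!: mult_right_mono\<close>)
  define R' where "R' = R + \<bar>yp N1\<bar> + \<bar>yn (- N2)\<bar>"
  have main: "norm (u z) \<le> C' * norm z" if z: "Re z \<ge> 0" "norm z \<ge> R'" for z
  proof -
    consider "Im z \<ge> yp N1" | "Im z \<le> yn (- N2)" | "yn (- N2) < Im z" "Im z < yp N1" by linarith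
    then show ?thesis
    proof cases
      case 1
      define j where "j = N1 + \<lfloor>(Im z - yp N1) / (2 * pi)\<rfloor>"
      have "of_int \<lfloor>(Im z - yp N1) / (2 * pi)\<rfloor> * (2 * pi) \<le> Im z - yp N1"
        using of_int_floor_le[of "(Im z - yp N1) / (2 * pi)"] by (simp only: pos_le_divide_eq mult_pos_pos pi_gt_zero zero_less_numeral)
      moreover have "Im z - yp N1 \<le> (of_int \<lfloor>(Im z - yp N1) / (2 * pi)\<rfloor> + 1) * (2 * pi)"
        using real_of_int_floor_add_one_ge[of "(Im z - yp N1) / (2 * pi)"] by (simp only: pos_divide_le_eq mult_pos_pos pi_gt_zero zero_less_numeral)
      ultimately have j: "yp j \<le> Im z" "Im z \<le> yp (j + 1)"
        by (simp_all add: j_def yp_def algebra_simps)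
      have "j \<ge> N1" using 1 by (simp add: j_def)
      then have yj: "yp j \<ge> yp N1" by (simp add: yp_def)
      have "norm (u z) \<le> (C + norm a * M + 1) * norm z"
      proof (rule strip_bound[where ?y1.0 = "yp j" and ?y2.0 = "yp (j + 1)" and ?x0.0 = 0])
        show "yp j < yp (j + 1)" by (simp add: yp_def)
        show dom: "R \<le> norm w" if "yp j \<le> Im w" for w
          using that yj yp abs_Im_le_cmod[of w] by linarith
        show "norm (u w) \<le> C * norm w" if "Re w = 0" "yp j \<le> Im w" for w
          using axis dom that by blast
        show "Re (exp w * k w) \<le> 0" if w: "0 \<le> Re w" "Im w = yp j \<or> Im w = yp (j + 1)" for w
        proof -
          have ge: "Im w \<ge> yp j" using w by (auto simp: yp_def)
          then have "Im w > 0" using yj yp R by linarith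
          moreover obtain j' where "Im w = yp j'" using w by blast
          ultimately show ?thesis
            using neg_on_line[OF w(1) dom[OF ge], of j'] by (simp add: yp_def g_def)
        qed
      qed (use j z C in auto)
      then show ?thesis by (rule mono) simp
    next
      case 2
      define j where "j = - N2 - \<lfloor>(yn (- N2) - Im z) / (2 * pi)\<rfloor>"
      have "of_int \<lfloor>(yn (- N2) - Im z) / (2 * pi)\<rfloor> * (2 * pi) \<le> yn (- N2) - Im z"
        using of_int_floor_le[of "(yn (- N2) - Im z) / (2 * pi)"] by (simp only: pos_le_divide_eq mult_pos_pos pi_gt_zero zero_less_numeral)
      moreover have "yn (- N2) - Im z \<le> (of_int \<lfloor>(yn (- N2) - Im z) / (2 * pi)\<rfloor> + 1) * (2 * pi)"
        using real_of_int_floor_add_one_ge[of "(yn (- N2) - Im z) / (2 * pi)"] by (simp only: pos_divide_le_eq mult_pos_pos pi_gt_zero zero_less_numeral)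
      ultimately have j: "Im z \<le> yn j" "yn (j - 1) \<le> Im z"
        by (simp_all add: j_def yn_def algebra_simps)
      have "j \<le> - N2" using 2 by (simp add: j_def)
      then have "real_of_int j \<le> real_of_int (- N2)" by (simp only: of_int_le_iff)
      then have "2 * pi * real_of_int j \<le> 2 * pi * real_of_int (- N2)"
        by (intro mult_left_mono) auto
      then have yj: "yn j \<le> yn (- N2)" unfolding yn_def by linarith
      have "norm (u z) \<le> (C + norm a * M + 1) * norm z"
      proof (rule strip_bound[where ?y1.0 = "yn (j - 1)" and ?y2.0 = "yn j" and ?x0.0 = 0])
        show "yn (j - 1) < yn j" by (simp add: yn_def)
        show dom: "R \<le> norm w" if "Im w \<le> yn j" for w
          using that yj yn abs_Im_le_cmod[of w] by linarith
        show "norm (u w) \<le> C * norm w" if "Re w = 0" "Im w \<le> yn j" for w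
          using axis dom that by blast
        show "Re (exp w * k w) \<le> 0" if w: "0 \<le> Re w" "Im w = yn (j - 1) \<or> Im w = yn j" for w
        proof -
          have ge: "Im w \<le> yn j" using w by (auto simp: yn_def)
          then have "Im w < 0" using yj yn R by linarith
          moreover obtain j' where "Im w = yn j'" using w by blast
          ultimately show ?thesis
            using neg_on_line[OF w(1) dom[OF ge], of j'] by (simp add: yn_def g_def)
        qed
      qed (use j z C in auto)
      then show ?thesis by (rule mono) simp
    next
      case 3
      have Rz: "Re z \<ge> R" using z 3 cmod_le[of z] by (simp add: R'_def)
      have dom: "R \<le> norm w" if "R \<le> Re w" for w using that complex_Re_le_cmod[of w] by linarith
      have "norm (u z) \<le> (B + norm a * M + 1) * norm z"
      proof (rule strip_bound[where ?y1.0 = "yn (- N2)" and ?y2.0 = "yp N1" and ?x0.0 = R])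
        show "R \<le> norm w" if "R \<le> Re w" for w by (rule dom[OF that])
        show "norm (u w) \<le> B * norm w" if w: "Re w = R" "yn (- N2) \<le> Im w" "Im w \<le> yp N1" for w
        proof -
          have "w \<in> S" using w by (auto simp: S_def in_cbox_complex_iff)
          then have "norm (u w) \<le> B * 1" using B by simp
          also have "\<dots> \<le> B * norm w" using dom[of w] w R B by (intro mult_left_mono) auto
          finally show ?thesis .
        qed
        show "Re (exp w * k w) \<le> 0" if w: "R \<le> Re w" "Im w = yn (- N2) \<or> Im w = yp N1" for w
          using w(2)
        proof
          assume "Im w = yn (- N2)"
          then show ?thesis using neg_on_line[of w "- N2"] dom[OF w(1)] w(1) yn R
            by (simp add: yn_def g_def)
        next
          assume "Im w = yp N1"
          then show ?thesis using neg_on_line[of w N1] dom[OF w(1)] w(1) yp R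
            by (simp add: yp_def g_def)
        qed
      qed (use 3 Rz R B y_less in auto)
      then show ?thesis by (rule mono) simp
    qed
  qed
  show ?thesis using main by (rule that)
qed

end

section \<open>Inverse charts of a polynomial near infinity\<close>

text \<open>
  Near infinity \<open>p z = w\<^sup>n\<close> for a coordinate \<open>w\<close>: with \<open>t = 1 / z\<close> and the reflected polynomial
  \<open>exp l\<close> of \<open>p\<close>, the function \<open>G t = t exp (- l t / n)\<close> satisfies \<open>(G t)\<^sup>n = 1 / p (1 / t)\<close>, and it is
  invertible at \<open>0\<close>.  The inverse yields \<open>\<psi>\<close> with \<open>p (\<psi> w) = w\<^sup>n\<close>, and \<open>q \<alpha> z = \<psi> (\<alpha> z\<^sup>1\<^sup>/\<^sup>n)\<close>, for the
  principal root, satisfies \<open>p (q \<alpha> z) = \<alpha>\<^sup>n z\<close>.  By the last property, the charts with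
  \<open>\<alpha>\<^sup>n = \<sigma>\<close> reach every \<open>z\<close> of large modulus at the parameter \<open>p z / \<sigma>\<close>; the other properties apply to
  this parameter if its real part is nonnegative and \<open>z\<close> is large enough.
\<close>
lemma poly_half_plane_charts:
  fixes p :: "complex poly"
  assumes n: "degree p > 0"
  defines "n \<equiv> degree p"
  obtains q e :: "complex \<Rightarrow> complex \<Rightarrow> complex" and \<kappa> :: complex and R B r :: real
  where "R \<ge> 1" "\<kappa> \<noteq> 0" "B > 0"
    "\<And>\<alpha> z. norm \<alpha> = 1 \<Longrightarrow> Re z \<ge> 0 \<Longrightarrow> norm z \<ge> R \<Longrightarrow> poly p (q \<alpha> z) = \<alpha> ^ n * z"
    "\<And>\<alpha> z. norm \<alpha> = 1 \<Longrightarrow> Re z \<ge> 0 \<Longrightarrow> norm z \<ge> R \<Longrightarrow>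
       (q \<alpha> has_field_derivative \<kappa> * \<alpha> * (1 + e \<alpha> z) * exp (- of_real (1 - 1 / n) * Ln z)) (at z)"
    "\<And>\<alpha> z. norm \<alpha> = 1 \<Longrightarrow> Re z \<ge> 0 \<Longrightarrow> norm z \<ge> R \<Longrightarrow> norm (e \<alpha> z) \<le> 1 / 4"
    "\<And>\<alpha> z. norm \<alpha> = 1 \<Longrightarrow> Re z \<ge> 0 \<Longrightarrow> norm z \<ge> R \<Longrightarrow> norm (q \<alpha> z) ^ n \<le> B * norm z"
    "\<And>z \<sigma>. norm z \<ge> r \<Longrightarrow> norm \<sigma> = 1 \<Longrightarrow> \<exists>\<alpha>. \<alpha> ^ n = \<sigma> \<and> q \<alpha> (poly p z / \<sigma>) = z"
proof -
  have n0: "n > 0" using assms by simp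
  have p0: "p \<noteq> 0" using n by auto
  define rp where "rp = reflect_poly p"
  have "poly rp 0 \<noteq> 0" using p0 by (simp add: rp_def)
  moreover have "isCont (poly rp) 0" by simp
  ultimately obtain r0 where r0: "r0 > 0" "\<And>t. norm t < r0 \<Longrightarrow> poly rp t \<noteq> 0"
    using continuous_at_avoid[of 0 "poly rp" 0] by (auto simp: dist_norm)
  have "poly rp holomorphic_on ball 0 r0"
    by (rule holomorphic_onI) (meson DERIV_subset field_differentiable_def poly_DERIV subset_UNIV)
  then obtain l where l: "l holomorphic_on ball 0 r0" "\<And>t. t \<in> ball 0 r0 \<Longrightarrow> exp (l t) = poly rp t"
    using holomorphic_logarithm_exists[of "ball 0 r0" "poly rp" 0] r0
    by auto
  define G where "G = (\<lambda>t. t * exp (- l t / of_nat n))"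
  have G: "G holomorphic_on ball 0 r0"
    unfolding G_def using n0 by (intro holomorphic_intros l(1)) auto
  have G0: "G 0 = 0" by (simp add: G_def)
  have G_nz: "G t \<noteq> 0" if "t \<noteq> 0" for t using that by (simp add: G_def)
  have Gpow: "G t ^ n * poly p (inverse t) = 1" if t: "t \<noteq> 0" "norm t < r0" for t
  proof -
    have "exp (- l t / of_nat n) ^ n = exp (- l t)"
      using n0 by (simp flip: exp_of_nat_mult)
    then have "G t ^ n = t ^ n / poly rp t"
      using l(2)[of t] t by (simp add: G_def power_mult_distrib exp_minus divide_inverse)
    moreover have "poly rp t = t ^ n * poly p (inverse t)"
      using poly_reflect_poly_nz[OF t(1), of p] by (simp add: rp_def n_def)
    ultimately show ?thesis using r0(2)[OF t(2)] t(1) by (simp add: field_simps)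
  qed
  have "(G has_field_derivative exp (- l 0 / of_nat n)) (at 0)"
  proof -
    have "l field_differentiable at 0"
      using holomorphic_on_imp_differentiable_at[OF l(1) open_ball, of 0] r0(1) by simp
    then obtain l' where "(l has_field_derivative l') (at 0)" by (auto simp: field_differentiable_def)
    then show ?thesis unfolding G_def using n0
      by (auto intro!: derivative_eq_intros)
  qed
  then have dG: "deriv G 0 \<noteq> 0" by (simp add: DERIV_imp_deriv)
  obtain r1 where r1: "r1 > 0" "ball (0::complex) r1 \<subseteq> ball 0 r0" "open (G ` ball 0 r1)" "inj_on G (ball 0 r1)"
    by (rule has_complex_derivative_locally_invertible[OF G _ open_ball dG]) (use r0(1) in auto)
  define V where "V = G ` ball 0 r1"
  have "G holomorphic_on ball 0 r1" using holomorphic_on_subset[OF G r1(2)] .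
  then obtain K where K: "K holomorphic_on V" "\<And>t. norm t < r1 \<Longrightarrow> deriv G t * deriv K (G t) = 1"
      "\<And>t. norm t < r1 \<Longrightarrow> K (G t) = t"
    by (rule holomorphic_has_inverse[OF _ open_ball r1(4), folded V_def]) auto
  have V: "open V" "0 \<in> V" using r1 G0 by (auto simp: V_def intro!: image_eqI[of _ _ 0])
  have K0: "K 0 = 0" using K(3)[of 0] r1(1) G0 by simp
  define k1 where "k1 = deriv K 0"
  have k1: "k1 \<noteq> 0" using K(2)[of 0] r1(1) G0 by (auto simp: k1_def)
  have GK: "G (K v) = v" "norm (K v) < r1" if "v \<in> V" for v
    using that K(3) by (auto simp: V_def)
  have K_nz: "K v \<noteq> 0" if "v \<in> V" "v \<noteq> 0" for v using GK[OF that(1)] G0 that(2) by metis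
  \<comment> \<open>\<open>H t = K t / t\<close> without its removable singularity; \<open>J\<close> is the relative error in \<open>\<psi>' \<approx> 1 / k1\<close>\<close>
  define H where "H = (\<lambda>t. if t = 0 then k1 else K t / t)"
  have "(\<lambda>t. if t = 0 then deriv K 0 else (K t - K 0) / (t - 0)) holomorphic_on V"
    by (rule pole_lemma_open[OF K(1) V(1)])
  moreover have "(\<lambda>t. if t = 0 then deriv K 0 else (K t - K 0) / (t - 0)) = H"
    by (auto simp: H_def k1_def K0)
  ultimately have H: "H holomorphic_on V" by simp
  have H_nz: "H t \<noteq> 0" if "t \<in> V" for t using K_nz[OF that] k1 by (auto simp: H_def)
  define J where "J = (\<lambda>t. k1 * deriv K t / H t ^ 2 - 1)"
  have "J holomorphic_on V" unfolding J_def
    by (intro holomorphic_intros K(1) V(1) H) (use H_nz in auto)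
  then have "isCont J 0" "isCont H 0"
    using H V holomorphic_on_imp_continuous_on continuous_on_eq_continuous_at by blast+
  moreover have "J 0 = 0" using k1 by (simp add: J_def H_def k1_def power2_eq_square)
  moreover have "H 0 = k1" by (simp add: H_def)
  ultimately have "(\<lambda>t. norm (J t)) \<midarrow>0\<rightarrow> 0" and "(\<lambda>t. norm (H t)) \<midarrow>0\<rightarrow> norm k1"
    using tendsto_norm[of J "J 0" "at 0"] tendsto_norm[of H "H 0" "at 0"]
    by (simp_all add: isCont_def)
  then have "eventually (\<lambda>t. norm (J t) < 1/4) (at 0)"
      "eventually (\<lambda>t. norm (H t) > norm k1 / 2) (at 0)"
    using k1 order_tendstoD(2)[of "\<lambda>t. norm (J t)" 0 "at 0" "1/4"]
      order_tendstoD(1)[of "\<lambda>t. norm (H t)" "norm k1" "at 0" "norm k1 / 2"] by simp_all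
  moreover have "eventually (\<lambda>t. t \<in> V) (at 0)" using V by (simp add: eventually_at_in_open')
  ultimately have "eventually (\<lambda>t. norm (J t) < 1/4 \<and> norm (H t) > norm k1 / 2 \<and> t \<in> V) (at 0)"
    by eventually_elim simp
  then obtain \<delta> where \<delta>: "\<delta> > 0" "\<And>t. t \<noteq> 0 \<Longrightarrow> norm t < \<delta> \<Longrightarrow>
       norm (J t) < 1/4 \<and> norm (H t) > norm k1 / 2 \<and> t \<in> V"
    unfolding eventually_at by (auto simp: dist_norm)
  define \<psi> where "\<psi> = (\<lambda>w. inverse (K (inverse w)))"
  have inv: "inverse w \<noteq> 0" "norm (inverse w) < \<delta>" if "norm w > 1 / \<delta>" for w :: complex
  proof -
    have "norm w > 0" using that \<delta>(1) by (meson le_less_trans less_imp_le zero_less_divide_1_iff)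
    moreover from this have "1 / norm w < \<delta>"
      using that \<delta>(1) by (simp add: divide_less_eq mult.commute)
    ultimately show "inverse w \<noteq> 0" "norm (inverse w) < \<delta>"
      by (auto simp: norm_inverse divide_inverse)
  qed
  have \<psi>_p: "poly p (\<psi> w) = w ^ n" if w: "norm w > 1 / \<delta>" for w
  proof -
    define t where "t = inverse w"
    have t: "t \<noteq> 0" "t \<in> V" using inv[OF w] \<delta>(2) by (auto simp: t_def)
    have "G (K t) ^ n * poly p (inverse (K t)) = 1"
      using GK[OF t(2)] K_nz[OF t(2,1)] r1(2) by (intro Gpow) auto
    then have "t ^ n * poly p (\<psi> w) = 1" unfolding GK(1)[OF t(2)] by (simp add: \<psi>_def t_def)
    then show ?thesis using t(1) by (simp add: t_def field_simps)
  qed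
  have \<psi>_d: "(\<psi> has_field_derivative (1 / k1) * (1 + J (inverse w))) (at w)"
    if w: "norm w > 1 / \<delta>" for w
  proof -
    define t where "t = inverse w"
    have t: "t \<noteq> 0" "t \<in> V" using inv[OF w] \<delta>(2) by (auto simp: t_def)
    have w0: "w \<noteq> 0" using t by (auto simp: t_def)
    have "(K has_field_derivative deriv K t) (at t)"
      using holomorphic_derivI[OF K(1) V(1) t(2)] .
    moreover have "(inverse has_field_derivative - (t\<^sup>2)) (at w)"
      using DERIV_inverse[OF w0] by (simp add: t_def power2_eq_square)
    ultimately have "((\<lambda>w. K (inverse w)) has_field_derivative deriv K t * (- (t\<^sup>2))) (at w)"
      unfolding t_def by (rule DERIV_chain2)
    from DERIV_inverse'[OF this] K_nz[OF t(2,1)]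
    have "(\<psi> has_field_derivative deriv K t * t\<^sup>2 / (K t)\<^sup>2) (at w)"
      by (simp add: \<psi>_def t_def power2_eq_square field_simps)
    moreover have "deriv K t * t\<^sup>2 / (K t)\<^sup>2 = (1 / k1) * (1 + J t)"
      using k1 t K_nz[OF t(2,1)] by (simp add: J_def H_def field_simps power2_eq_square)
    ultimately show ?thesis by (simp add: t_def)
  qed
  have \<psi>_le: "norm (\<psi> w) \<le> 2 / norm k1 * norm w" if w: "norm w > 1 / \<delta>" for w
  proof -
    define t where "t = inverse w"
    have t: "t \<noteq> 0" "norm (H t) > norm k1 / 2" using inv[OF w] \<delta>(2) by (auto simp: t_def)
    have "\<psi> w = w / H t" using t(1) by (auto simp: \<psi>_def H_def t_def field_simps)
    then have "norm (\<psi> w) = norm w / norm (H t)" by (simp add: norm_divide)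
    also have "\<dots> \<le> norm w / (norm k1 / 2)"
      using t(2) k1 by (intro divide_left_mono mult_pos_pos) (auto intro: less_trans[of 0 "norm k1 / 2"])
    finally show ?thesis by (simp add: field_simps)
  qed
  have "G \<midarrow>0\<rightarrow> 0"
  proof -
    have "continuous_on (ball 0 r0) G" using G holomorphic_on_imp_continuous_on by blast
    then have "isCont G 0" using r0(1) continuous_on_eq_continuous_at[of "ball 0 r0" G] by auto
    then show ?thesis by (simp add: isCont_def G0)
  qed
  then obtain \<delta>2 where \<delta>2: "\<delta>2 > 0" "\<And>t. t \<noteq> 0 \<Longrightarrow> norm t < \<delta>2 \<Longrightarrow> norm (G t) < \<delta>"
    using \<delta>(1) unfolding LIM_def by (auto simp: dist_norm)
  have surj: "\<exists>w. norm w > 1 / \<delta> \<and> \<psi> w = z" if z: "norm z \<ge> 1 + 1 / r1 + 1 / \<delta>2" for z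
  proof -
    have pos: "1 / r1 > 0" "1 / \<delta>2 > 0" using r1(1) \<delta>2(1) by auto
    then have z': "norm z > 1 / r1" "norm z > 1 / \<delta>2" "norm z > 0" using z by linarith+
    define s where "s = inverse z"
    have s: "s \<noteq> 0" "norm s < r1" "norm s < \<delta>2"
      using z' r1(1) \<delta>2(1) unfolding s_def norm_inverse by (auto simp: field_simps)
    define w where "w = inverse (G s)"
    have "norm (G s) < \<delta>" "norm (G s) > 0" using \<delta>2(2)[OF s(1,3)] G_nz[OF s(1)] by auto
    then have "norm w > 1 / \<delta>" using \<delta>(1) unfolding w_def norm_inverse by (simp add: field_simps)
    moreover have "\<psi> w = z" using K(3)[OF s(2)] by (simp add: \<psi>_def w_def s_def)
    ultimately show ?thesis by blast
  qed
  define R0 where "R0 = max 1 (1 / \<delta>)"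
  define R where "R = R0 ^ n + 1"
  have R0: "R0 \<ge> 1" by (simp add: R0_def)
  have R: "R \<ge> 1" using R0 by (simp add: R_def)
  define rt where "rt = (\<lambda>z. exp (Ln z / of_nat n))"
  define q where "q = (\<lambda>\<alpha> z. \<psi> (\<alpha> * rt z))"
  define e where "e = (\<lambda>\<alpha> z. J (inverse (\<alpha> * rt z)))"
  define \<kappa> where "\<kappa> = 1 / (k1 * of_nat n)"
  have rt_pow: "rt z ^ n = z" if "z \<noteq> 0" for z
    unfolding rt_def using n0 that by (simp flip: exp_of_nat_mult)
  have dom: "norm (\<alpha> * rt z) > 1 / \<delta>" "z \<noteq> 0" if "norm \<alpha> = 1" "norm z \<ge> R" for \<alpha> z
  proof -
    show z0: "z \<noteq> 0" using that R by auto
    have "norm (rt z) ^ n = norm z" using rt_pow[OF z0] by (metis norm_power)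
    then have "norm (rt z) ^ n > R0 ^ n" using that by (simp add: R_def)
    then have "norm (rt z) > R0" using R0 by (meson norm_ge_zero power_less_imp_less_base)
    then show "norm (\<alpha> * rt z) > 1 / \<delta>" using that by (simp add: norm_mult R0_def)
  qed
  show ?thesis
  proof (rule that[of R \<kappa> "(2 / norm k1) ^ n" q e "1 + 1 / r1 + 1 / \<delta>2"])
    show "R \<ge> 1" by (rule R)
    show "\<kappa> \<noteq> 0" using k1 n0 by (simp add: \<kappa>_def)
    show "(2 / norm k1) ^ n > 0" using k1 by simp
  next
    fix \<alpha> z :: complex assume a: "norm \<alpha> = 1" "Re z \<ge> 0" "norm z \<ge> R"
    note d = dom[OF a(1,3)]
    show "poly p (q \<alpha> z) = \<alpha> ^ n * z"
      using \<psi>_p[OF d(1)] rt_pow[OF d(2)] by (simp add: q_def power_mult_distrib)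
    show "norm (e \<alpha> z) \<le> 1 / 4"
      using \<delta>(2)[OF inv[OF d(1)]] by (simp add: e_def)
    have "norm (q \<alpha> z) ^ n \<le> (2 / norm k1 * norm (\<alpha> * rt z)) ^ n"
      unfolding q_def by (intro power_mono \<psi>_le d(1)) simp
    also have "\<dots> = (2 / norm k1) ^ n * norm (rt z ^ n)"
      using a(1) by (simp add: power_mult_distrib norm_mult norm_power power_divide)
    finally show "norm (q \<alpha> z) ^ n \<le> (2 / norm k1) ^ n * norm z" by (simp add: rt_pow[OF d(2)])
    have z_nonpos: "z \<notin> \<real>\<^sub>\<le>\<^sub>0" using a(2) d(2) by (auto simp: complex_nonpos_Reals_iff complex_eq_iff)
    have "(rt has_field_derivative rt z * (inverse z / of_nat n)) (at z)"
      unfolding rt_def using n0 by (auto intro!: derivative_eq_intros z_nonpos simp: divide_inverse)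
    then have "((\<lambda>z. \<alpha> * rt z) has_field_derivative \<alpha> * (rt z * (inverse z / of_nat n))) (at z)"
      by (rule DERIV_cmult)
    from DERIV_chain2[OF \<psi>_d[OF d(1)] this]
    have der: "(q \<alpha> has_field_derivative
        (1 / k1 * (1 + e \<alpha> z)) * (\<alpha> * (rt z * (inverse z / of_nat n)))) (at z)"
      by (simp add: q_def[abs_def] e_def)
    have rt_inverse: "rt z * inverse z = exp (- of_real (1 - 1 / n) * Ln z)"
    proof -
      have "inverse z = exp (- Ln z)" using d(2) by (simp add: exp_minus)
      then have "rt z * inverse z = exp (Ln z / of_nat n + - Ln z)"
        unfolding rt_def by (simp only: exp_add)
      also have "Ln z / of_nat n + - Ln z = - of_real (1 - 1 / n) * Ln z"
        by (simp add: algebra_simps)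
      finally show ?thesis .
    qed
    have "(1 / k1 * (1 + e \<alpha> z)) * (\<alpha> * (rt z * (inverse z / of_nat n))) =
        \<kappa> * \<alpha> * (1 + e \<alpha> z) * (rt z * inverse z)"
      using k1 n0 by (simp add: \<kappa>_def)
    with der show "(q \<alpha> has_field_derivative
        \<kappa> * \<alpha> * (1 + e \<alpha> z) * exp (- of_real (1 - 1 / n) * Ln z)) (at z)"
      unfolding rt_inverse by (simp only:)
  next
    fix z \<sigma> :: complex assume a: "norm z \<ge> 1 + 1 / r1 + 1 / \<delta>2" "norm \<sigma> = 1"
    obtain w where w: "norm w > 1 / \<delta>" "\<psi> w = z" using surj[OF a(1)] by blast
    have w0: "w \<noteq> 0" using inv(1)[OF w(1)] by auto
    have pz: "poly p z = w ^ n" using \<psi>_p[OF w(1)] w(2) by simp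
    define \<zeta> where "\<zeta> = poly p z / \<sigma>"
    have \<sigma>0: "\<sigma> \<noteq> 0" using a(2) by auto
    have \<zeta>0: "\<zeta> \<noteq> 0" using pz w0 \<sigma>0 by (simp add: \<zeta>_def)
    have rt0: "rt \<zeta> \<noteq> 0" by (simp add: rt_def)
    define \<alpha> where "\<alpha> = w / rt \<zeta>"
    have "\<alpha> ^ n = w ^ n / \<zeta>" using rt_pow[OF \<zeta>0] by (simp add: \<alpha>_def power_divide)
    also have "\<dots> = \<sigma>" using pz \<sigma>0 w0 by (simp add: \<zeta>_def)
    finally have "\<alpha> ^ n = \<sigma>" .
    moreover have "q \<alpha> \<zeta> = z" using rt0 w(2) by (simp add: q_def \<alpha>_def)
    ultimately show "\<exists>\<alpha>. \<alpha> ^ n = \<sigma> \<and> q \<alpha> (poly p z / \<sigma>) = z" unfolding \<zeta>_def by blast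
  qed
qed

section \<open>Solutions of slow growth vanish\<close>

text \<open>
  A solution dominated by \<open>p\<close> is a polynomial \<open>P\<close>, and so is \<open>Q = P' - a = exp p * P\<close>.  Differentiating
  gives \<open>p' P Q = P Q' - Q P'\<close>, which is impossible for nonzero \<open>P\<close> by comparing degrees.
\<close>
lemma poly_ode_poly_bound_imp_zero:
  fixes F :: "complex \<Rightarrow> complex" and a :: complex and p :: "complex poly"
  assumes F: "F holomorphic_on UNIV" and n: "degree p > 0"
    and ode: "\<And>z. deriv F z = exp (poly p z) * F z + a"
    and bound: "\<And>z. norm z \<ge> X \<Longrightarrow> norm (F z) \<le> D * norm (poly p z)"
  shows "F z = 0"
proof -
  obtain C where C: "C > 0" "\<And>z. norm (poly p z) \<le> C * (1 + norm z) ^ degree p"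
    using poly_norm_bound[of p] by blast
  define A where "A = max X 1"
  define B where "B = \<bar>D\<bar> * C * 2 ^ degree p"
  have "norm (F z) \<le> B * norm z ^ degree p" if "norm z \<ge> A" for z
  proof -
    have z: "norm z \<ge> X" "norm z \<ge> 1" using that by (auto simp: A_def)
    have "norm (F z) \<le> D * norm (poly p z)" by (rule bound[OF z(1)])
    also have "\<dots> \<le> \<bar>D\<bar> * norm (poly p z)" by (intro mult_right_mono) auto
    also have "\<dots> \<le> \<bar>D\<bar> * (C * (2 * norm z) ^ degree p)"
    proof (rule mult_left_mono)
      have "C * (1 + norm z) ^ degree p \<le> C * (2 * norm z) ^ degree p"
        using z C(1) by (intro mult_left_mono power_mono) auto
      then show "norm (poly p z) \<le> C * (2 * norm z) ^ degree p"
        using C(2)[of z] by linarith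
    qed simp
    also have "\<dots> = B * norm z ^ degree p" by (simp add: B_def power_mult_distrib)
    finally show ?thesis .
  qed
  then have Fsum: "F z = (\<Sum>k\<le>degree p. (deriv ^^ k) F 0 / fact k * z ^ k)" for z
    by (rule Liouville_polynomial[OF F])
  define P where "P = (\<Sum>k\<le>degree p. monom ((deriv ^^ k) F 0 / fact k) k)"
  have FP: "F z = poly P z" for z
    by (subst Fsum) (simp only: P_def poly_sum poly_monom)
  then have FP': "F = poly P" by (rule ext)
  have dF: "deriv F z = poly (pderiv P) z" for z
    by (subst FP') (rule DERIV_imp_deriv[OF poly_DERIV])
  define Q where "Q = pderiv P - [:a:]"
  have Q: "poly Q z = exp (poly p z) * poly P z" for z
    using ode[of z] by (simp add: Q_def dF FP)
  have dQ: "poly (pderiv Q) z = exp (poly p z) * (poly (pderiv p) z * poly P z + poly (pderiv P) z)" for z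
  proof -
    have "(poly Q has_field_derivative poly (pderiv Q) z) (at z)" by (rule poly_DERIV)
    moreover have "((\<lambda>z. exp (poly p z) * poly P z) has_field_derivative
        exp (poly p z) * (poly (pderiv p) z * poly P z + poly (pderiv P) z)) (at z)"
      by (auto intro!: derivative_eq_intros poly_DERIV simp: algebra_simps)
    moreover have "poly Q = (\<lambda>z. exp (poly p z) * poly P z)" by (rule ext) (rule Q)
    ultimately show ?thesis using DERIV_unique by metis
  qed
  have "poly (P * pderiv Q) = poly (Q * (pderiv p * P + pderiv P))"
    by (rule ext) (simp add: Q dQ)
  then have "P * pderiv Q = Q * (pderiv p * P + pderiv P)"
    unfolding poly_eq_poly_eq_iff .
  then have eq: "pderiv p * P * Q = P * pderiv Q - Q * pderiv P"
    by (simp add: algebra_simps)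
  have "P = 0"
  proof (rule ccontr)
    assume P0: "P \<noteq> 0"
    have "Q \<noteq> 0"
    proof
      assume "Q = 0"
      then have "poly P z = poly 0 z" for z using Q[of z] by simp
      then have "poly P = poly 0" by (rule ext)
      then show False using P0 by (simp only: poly_eq_poly_eq_iff)
    qed
    moreover have "pderiv p \<noteq> 0" using n by (simp add: pderiv_eq_0_iff)
    ultimately have deg: "degree (pderiv p * P * Q) \<ge> degree P + degree Q" and nz: "pderiv p * P * Q \<noteq> 0"
      using P0 by (simp_all add: degree_mult_eq)
    show False
    proof (cases "degree P + degree Q = 0")
      case True
      then have "pderiv P = 0" "pderiv Q = 0" by (simp_all add: pderiv_eq_0_iff)
      then show False using eq nz by simp
    next
      case False
      have "degree (R * pderiv S) < degree R + degree S" if "degree R + degree S \<noteq> 0" for R S :: "complex poly"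
      proof (cases "degree S = 0")
        case True
        then have "pderiv S = 0" by (simp add: pderiv_eq_0_iff)
        then show ?thesis using that by simp
      next
        case False
        have "degree (R * pderiv S) \<le> degree R + degree (pderiv S)" by (rule degree_mult_le)
        also have "\<dots> < degree R + degree S" using False by (simp add: degree_pderiv)
        finally show ?thesis .
      qed
      then have "degree (P * pderiv Q) < degree P + degree Q" "degree (Q * pderiv P) < degree P + degree Q"
        using False by (metis add.commute)+
      then have "degree (P * pderiv Q - Q * pderiv P) < degree P + degree Q"
        by (rule degree_diff_less)
      then show False using deg eq by simp
    qed
  qed
  then show ?thesis by (simp add: FP)
qed

lemma finite_uniform_constant:
  fixes P :: "'a \<Rightarrow> real \<Rightarrow> bool"
  assumes "finite A" "\<And>x. x \<in> A \<Longrightarrow> \<exists>C. P x C" "\<And>x C D. P x C \<Longrightarrow> C \<le> D \<Longrightarrow> P x D"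
  shows "\<exists>C. \<forall>x\<in>A. P x C"
proof -
  obtain c where c: "\<And>x. x \<in> A \<Longrightarrow> P x (c x)" using assms(2) by metis
  have "\<forall>x\<in>A. P x (Max (insert 0 (c ` A)))"
    using assms(1) by (auto intro!: assms(3)[OF c] Max_ge)
  then show ?thesis by blast
qed

text \<open>
  The growth hypothesis says in the coordinate \<open>\<zeta> = p z\<close> that \<open>F\<close> grows more slowly than every
  \<open>exp (exp (d * norm \<zeta>))\<close>.  For each of the finitely many charts this makes \<open>F\<close> linearly bounded in
  \<open>\<zeta>\<close>, hence \<open>F = O(p)\<close>.
\<close>
lemma poly_ode_slow_growth_imp_zero:
  fixes F :: "complex \<Rightarrow> complex" and a :: complex and p :: "complex poly"
  assumes F: "F holomorphic_on UNIV" and n: "degree p > 0"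
    and ode: "\<And>z. deriv F z = exp (poly p z) * F z + a"
    and growth: "\<And>d. d > 0 \<Longrightarrow> \<exists>X. \<forall>z. norm z \<ge> X \<longrightarrow> norm (F z) \<le> exp (exp (d * norm z ^ degree p))"
  shows "F z = 0"
proof -
  define n where "n = degree p"
  have n0: "n > 0" using n by (simp add: n_def)
  obtain q e :: "complex \<Rightarrow> complex \<Rightarrow> complex" and \<kappa> :: complex and R B r :: real
    where R: "R \<ge> 1" and \<kappa>: "\<kappa> \<noteq> 0" and B: "B > 0"
    and qp: "\<And>\<alpha> z. norm \<alpha> = 1 \<Longrightarrow> Re z \<ge> 0 \<Longrightarrow> norm z \<ge> R \<Longrightarrow> poly p (q \<alpha> z) = \<alpha> ^ n * z"
    and qd: "\<And>\<alpha> z. norm \<alpha> = 1 \<Longrightarrow> Re z \<ge> 0 \<Longrightarrow> norm z \<ge> R \<Longrightarrow>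
       (q \<alpha> has_field_derivative \<kappa> * \<alpha> * (1 + e \<alpha> z) * exp (- of_real (1 - 1 / n) * Ln z)) (at z)"
    and e: "\<And>\<alpha> z. norm \<alpha> = 1 \<Longrightarrow> Re z \<ge> 0 \<Longrightarrow> norm z \<ge> R \<Longrightarrow> norm (e \<alpha> z) \<le> 1 / 4"
    and qB: "\<And>\<alpha> z. norm \<alpha> = 1 \<Longrightarrow> Re z \<ge> 0 \<Longrightarrow> norm z \<ge> R \<Longrightarrow> norm (q \<alpha> z) ^ n \<le> B * norm z"
    and qsurj: "\<And>z \<sigma>. norm z \<ge> r \<Longrightarrow> norm \<sigma> = 1 \<Longrightarrow> \<exists>\<alpha>. \<alpha> ^ n = \<sigma> \<and> q \<alpha> (poly p z / \<sigma>) = z"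
    unfolding n_def by (rule poly_half_plane_charts[OF n]) blast
  obtain C0 where C0: "C0 > 0" "\<And>z. norm (poly p z) \<le> C0 * (1 + norm z) ^ n"
    using poly_norm_bound[of p] unfolding n_def by blast
  have alpha1: "norm \<alpha> = 1" if "\<alpha> ^ n = \<sigma>" "norm \<sigma> = 1" for \<alpha> \<sigma> :: complex
  proof -
    have "norm \<alpha> ^ n = 1" using that by (metis norm_power)
    then show ?thesis using n0 power_eq_imp_eq_base[of "norm \<alpha>" n 1] by simp
  qed
  have q_large: "norm (q \<alpha> z) > X"
    if "norm \<alpha> = 1" "Re z \<ge> 0" "norm z \<ge> R" "norm z > C0 * (1 + \<bar>X\<bar>) ^ n" for \<alpha> z X
  proof (rule ccontr)
    assume "\<not> norm (q \<alpha> z) > X"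
    then have "C0 * (1 + norm (q \<alpha> z)) ^ n \<le> C0 * (1 + \<bar>X\<bar>) ^ n"
      using C0(1) by (intro mult_left_mono power_mono) auto
    moreover have "norm (poly p (q \<alpha> z)) = norm z"
      using qp[OF that(1-3)] that(1) by (simp add: norm_mult norm_power)
    ultimately show False using C0(2)[of "q \<alpha> z"] that(4) by linarith
  qed
  define k where "k = (\<lambda>\<alpha> z. \<kappa> * \<alpha> * (1 + e \<alpha> z) * exp (- of_real (1 - 1 / n) * Ln z))"
  define M where "M = norm \<kappa> * 2"
  have kM: "norm (k \<alpha> z) \<le> M" if a: "norm \<alpha> = 1" "Re z \<ge> 0" "norm z \<ge> R" for \<alpha> z
  proof -
    have z0: "z \<noteq> 0" using a R by auto
    have "norm (1 + e \<alpha> z) \<le> 1 + norm (e \<alpha> z)" using norm_triangle_ineq[of 1 "e \<alpha> z"] by simp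
    then have "norm (1 + e \<alpha> z) \<le> 2" using e[OF a] by linarith
    moreover have "norm (exp (- of_real (1 - 1 / n) * Ln z)) = exp (- ((1 - 1 / n) * ln (norm z)))"
      using z0 by (simp add: algebra_simps)
    moreover have "(1 - 1 / n) * ln (norm z) \<ge> 0"
      using n0 a R by (intro mult_nonneg_nonneg) auto
    ultimately have "norm (1 + e \<alpha> z) * norm (exp (- of_real (1 - 1 / n) * Ln z)) \<le> 2 * 1"
      by (intro mult_mono) auto
    then show ?thesis
      unfolding k_def M_def norm_mult mult.assoc using a(1) by (simp add: mult_left_mono)
  qed
  have ud: "((\<lambda>z. F (q \<alpha> z)) has_field_derivative (exp (\<alpha> ^ n * z) * F (q \<alpha> z) + a) * k \<alpha> z) (at z)"
    if al: "norm \<alpha> = 1" "Re z \<ge> 0" "norm z \<ge> R" for \<alpha> z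
  proof -
    have "(F has_field_derivative deriv F (q \<alpha> z)) (at (q \<alpha> z))"
      using holomorphic_derivI[OF F] by simp
    then have "(F has_field_derivative (exp (\<alpha> ^ n * z) * F (q \<alpha> z) + a)) (at (q \<alpha> z))"
      unfolding ode qp[OF al] .
    from DERIV_chain2[OF this qd[OF al]] show ?thesis unfolding k_def .
  qed
  define lin_bd where "lin_bd = (\<lambda>\<alpha> C. \<forall>z. Re z \<ge> 0 \<and> norm z \<ge> C \<longrightarrow> norm (F (q \<alpha> z)) \<le> C * norm z)"
  have lin_bd_mono: "lin_bd \<alpha> D" if "lin_bd \<alpha> C" "C \<le> D" for \<alpha> C D
    unfolding lin_bd_def
  proof (intro allI impI)
    fix z :: complex assume z: "Re z \<ge> 0 \<and> norm z \<ge> D"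
    then have "norm (F (q \<alpha> z)) \<le> C * norm z" using that by (auto simp: lin_bd_def)
    also have "\<dots> \<le> D * norm z" using that by (intro mult_right_mono) auto
    finally show "norm (F (q \<alpha> z)) \<le> D * norm z" .
  qed
  have lin_bd_intro: "\<exists>C. lin_bd \<alpha> C"
    if "\<And>z. Re z \<ge> 0 \<Longrightarrow> norm z \<ge> R' \<Longrightarrow> norm (F (q \<alpha> z)) \<le> C * norm z" for R' \<alpha> C
    unfolding lin_bd_def
  proof (intro exI[of _ "max C R'"] allI impI)
    fix z :: complex assume z: "Re z \<ge> 0 \<and> norm z \<ge> max C R'"
    then have "norm (F (q \<alpha> z)) \<le> C * norm z" using that by auto
    also have "\<dots> \<le> max C R' * norm z" by (intro mult_right_mono) auto
    finally show "norm (F (q \<alpha> z)) \<le> max C R' * norm z" .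
  qed
  have fin: "finite {\<alpha>::complex. \<alpha> ^ n = \<sigma>}" for \<sigma>
    using finite_nth_roots[of n \<sigma>] n0 by simp
  have to_z: "\<exists>X. \<forall>z. norm z \<ge> X \<and> Re (poly p z / \<sigma>) \<ge> 0 \<longrightarrow> norm (F z) \<le> X * norm (poly p z)"
    if C: "\<And>\<alpha>. \<alpha> \<in> {\<alpha>. \<alpha> ^ n = \<sigma>} \<Longrightarrow> lin_bd \<alpha> C" and \<sigma>: "norm \<sigma> = 1" for C \<sigma>
  proof -
    have "filterlim (poly p) at_infinity at_infinity" by (rule filterlim_poly_at_infinity[OF n])
    then have "eventually (\<lambda>z. norm (poly p z) \<ge> C) at_infinity"
      unfolding filterlim_at_infinity_conv_norm_at_top filterlim_at_top by blast
    then obtain X0 where X0: "\<And>z. norm z \<ge> X0 \<Longrightarrow> norm (poly p z) \<ge> C"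
      by (auto simp: eventually_at_infinity)
    show ?thesis
    proof (intro exI[of _ "max C (max X0 r)"] allI impI)
      fix z assume z: "max C (max X0 r) \<le> norm z \<and> Re (poly p z / \<sigma>) \<ge> 0"
      obtain \<alpha> where \<alpha>: "\<alpha> ^ n = \<sigma>" "q \<alpha> (poly p z / \<sigma>) = z" using qsurj[of z \<sigma>] z \<sigma> by auto
      have "norm (poly p z / \<sigma>) = norm (poly p z)" using \<sigma> by (simp add: norm_divide)
      then have "norm (F z) \<le> C * norm (poly p z)"
        using C[of \<alpha>] \<alpha> z X0[of z] unfolding lin_bd_def by fastforce
      also have "\<dots> \<le> max C (max X0 r) * norm (poly p z)" by (intro mult_right_mono) auto
      finally show "norm (F z) \<le> max C (max X0 r) * norm (poly p z)" .
    qed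
  qed
  have neg: "\<exists>C. lin_bd \<alpha> C" if "\<alpha> \<in> {\<alpha>. \<alpha> ^ n = - 1}" for \<alpha>
  proof -
    have a: "\<alpha> ^ n = - 1" "norm \<alpha> = 1" using that alpha1[of \<alpha> "- 1"] by auto
    have ode': "((\<lambda>z. F (q \<alpha> z)) has_field_derivative (exp (- z) * F (q \<alpha> z) + a) * k \<alpha> z) (at z)"
      if "Re z \<ge> 0" "norm z \<ge> R" for z
      using ud[OF a(2) that] by (simp only: a(1) mult_minus1)
    show ?thesis
    proof (rule decaying_ode_linear_bound[of R "\<lambda>z. F (q \<alpha> z)" a "k \<alpha>" M])
      fix C assume "\<And>z. Re z \<ge> 0 \<Longrightarrow> norm z \<ge> 2 * R \<Longrightarrow> norm (F (q \<alpha> z)) \<le> C * norm z"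
      then show ?thesis by (rule lin_bd_intro)
    qed (use R ode' kM[OF a(2)] in auto)
  qed
  have "\<exists>C. \<forall>\<alpha>\<in>{\<alpha>. \<alpha> ^ n = - 1}. lin_bd \<alpha> C"
  proof (rule finite_uniform_constant[OF fin])
    show "\<exists>C. lin_bd \<alpha> C" if "\<alpha> \<in> {\<alpha>. \<alpha> ^ n = - 1}" for \<alpha> by (rule neg[OF that])
    show "lin_bd \<alpha> D" if "lin_bd \<alpha> C" "C \<le> D" for \<alpha> C D by (rule lin_bd_mono[OF that])
  qed
  then obtain Cm where Cm: "\<And>\<alpha>. \<alpha> \<in> {\<alpha>. \<alpha> ^ n = - 1} \<Longrightarrow> lin_bd \<alpha> Cm"
    by blast
  obtain Xm where Xm: "\<And>z. norm z \<ge> Xm \<Longrightarrow> Re (poly p z) \<le> 0 \<Longrightarrow> norm (F z) \<le> Xm * norm (poly p z)"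
    using to_z[where \<sigma> = "- 1", OF Cm] by auto
  \<comment> \<open>The bound where \<open>Re (p z) \<le> 0\<close> includes the points with \<open>Re (p z) = 0\<close>, which the charts with
     \<open>\<alpha> ^ n = 1\<close> place on the imaginary axis.\<close>
  have pos: "\<exists>C. lin_bd \<alpha> C" if "\<alpha> \<in> {\<alpha>. \<alpha> ^ n = 1}" for \<alpha>
  proof -
    have a: "\<alpha> ^ n = 1" "norm \<alpha> = 1" using that alpha1[of \<alpha> 1] by auto
    define R1 where "R1 = R + C0 * (1 + \<bar>Xm\<bar>) ^ n + 1"
    have "C0 * (1 + \<bar>Xm\<bar>) ^ n \<ge> 0" using C0(1) by (intro mult_nonneg_nonneg) auto
    then have R1: "R1 \<ge> R" "R1 \<ge> 1" "R1 > C0 * (1 + \<bar>Xm\<bar>) ^ n" using R by (auto simp: R1_def)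
    have "right_half_plane_ode (\<lambda>z. F (q \<alpha> z)) (k \<alpha>) (e \<alpha>) a (\<kappa> * \<alpha>) M R1 (1 - 1 / n) \<bar>Xm\<bar>"
    proof
      fix z :: complex assume z: "Re z \<ge> 0" "norm z \<ge> R1"
      then have zR: "norm z \<ge> R" using R1 by simp
      show "((\<lambda>z. F (q \<alpha> z)) has_field_derivative (exp z * F (q \<alpha> z) + a) * k \<alpha> z) (at z)"
        using ud[OF a(2) z(1) zR] a(1) by simp
      show "norm (k \<alpha> z) \<le> M" by (rule kM[OF a(2) z(1) zR])
      show "norm (e \<alpha> z) \<le> 1 / 4" by (rule e[OF a(2) z(1) zR])
      show "k \<alpha> z = \<kappa> * \<alpha> * (1 + e \<alpha> z) * exp (- of_real (1 - 1 / n) * Ln z)" by (simp add: k_def)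
    next
      fix z :: complex assume z: "Re z = 0" "norm z \<ge> R1"
      have zR: "norm z \<ge> R" "norm z > C0 * (1 + \<bar>Xm\<bar>) ^ n" using R1 z by auto
      have pq: "poly p (q \<alpha> z) = z" using qp[OF a(2) _ zR(1)] z a(1) by simp
      have "norm (q \<alpha> z) \<ge> Xm" using q_large[OF a(2) _ zR] z by force
      then have "norm (F (q \<alpha> z)) \<le> Xm * norm z" using Xm[of "q \<alpha> z"] z pq by simp
      also have "\<dots> \<le> \<bar>Xm\<bar> * norm z" by (intro mult_right_mono) auto
      finally show "norm (F (q \<alpha> z)) \<le> \<bar>Xm\<bar> * norm z" .
    next
      fix d :: real assume d: "d > 0"
      obtain X where X: "\<And>z. norm z \<ge> X \<Longrightarrow> norm (F z) \<le> exp (exp (d / B * norm z ^ n))"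
        using growth[of "d / B"] d B unfolding n_def by auto
      define X' where "X' = R + C0 * (1 + \<bar>X\<bar>) ^ n + 1"
      have "C0 * (1 + \<bar>X\<bar>) ^ n \<ge> 0" using C0(1) by (intro mult_nonneg_nonneg) auto
      then have X': "X' \<ge> R" "X' > C0 * (1 + \<bar>X\<bar>) ^ n" using R by (auto simp: X'_def)
      show "\<exists>X. \<forall>z. 0 \<le> Re z \<and> X \<le> norm z \<longrightarrow> norm (F (q \<alpha> z)) \<le> exp (exp (d * norm z))"
      proof (intro exI[of _ X'] allI impI)
        fix z :: complex assume z: "0 \<le> Re z \<and> X' \<le> norm z"
        have zR: "Re z \<ge> 0" "norm z \<ge> R" "norm z > C0 * (1 + \<bar>X\<bar>) ^ n" using X' z by auto
        have "norm (F (q \<alpha> z)) \<le> exp (exp (d / B * norm (q \<alpha> z) ^ n))"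
          using q_large[OF a(2) zR] by (intro X) simp
        also have "d / B * norm (q \<alpha> z) ^ n \<le> d / B * (B * norm z)"
          using qB[OF a(2) zR(1,2)] d B by (intro mult_left_mono) auto
        also have "\<dots> = d * norm z" using B by simp
        finally show "norm (F (q \<alpha> z)) \<le> exp (exp (d * norm z))" by simp
      qed
    next
      show "\<kappa> * \<alpha> \<noteq> 0" using \<kappa> a(2) by auto
    qed (use R1 n0 in auto)
    then show ?thesis
    proof (rule right_half_plane_ode.linear_bound)
      fix C R' assume "\<And>z. Re z \<ge> 0 \<Longrightarrow> norm z \<ge> R' \<Longrightarrow> norm (F (q \<alpha> z)) \<le> C * norm z"
      then show ?thesis by (rule lin_bd_intro)
    qed
  qed
  have "\<exists>C. \<forall>\<alpha>\<in>{\<alpha>. \<alpha> ^ n = 1}. lin_bd \<alpha> C"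
  proof (rule finite_uniform_constant[OF fin])
    show "\<exists>C. lin_bd \<alpha> C" if "\<alpha> \<in> {\<alpha>. \<alpha> ^ n = 1}" for \<alpha> by (rule pos[OF that])
    show "lin_bd \<alpha> D" if "lin_bd \<alpha> C" "C \<le> D" for \<alpha> C D by (rule lin_bd_mono[OF that])
  qed
  then obtain Cp where Cp: "\<And>\<alpha>. \<alpha> \<in> {\<alpha>. \<alpha> ^ n = 1} \<Longrightarrow> lin_bd \<alpha> Cp"
    by blast
  obtain Xp where Xp: "\<And>z. norm z \<ge> Xp \<Longrightarrow> Re (poly p z) \<ge> 0 \<Longrightarrow> norm (F z) \<le> Xp * norm (poly p z)"
    using to_z[where \<sigma> = 1, OF Cp] by auto
  show ?thesis
  proof (rule poly_ode_poly_bound_imp_zero[OF F n ode])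
    fix z :: complex assume z: "norm z \<ge> max Xm Xp"
    have "norm (F z) \<le> Xm * norm (poly p z) \<or> norm (F z) \<le> Xp * norm (poly p z)"
      using Xm[of z] Xp[of z] z by (cases "Re (poly p z) \<ge> 0") auto
    moreover have "Xm * norm (poly p z) \<le> max Xm Xp * norm (poly p z)"
      "Xp * norm (poly p z) \<le> max Xm Xp * norm (poly p z)"
      by (intro mult_right_mono; simp)+
    ultimately show "norm (F z) \<le> max Xm Xp * norm (poly p z)" by linarith
  qed
qed

section \<open>Entire functions sharing a value with their derivative\<close>

theorem theorem4p1:
  fixes f :: "complex \<Rightarrow> complex" and a :: complex
  assumes "f holomorphic_on UNIV"
    and "\<not> f constant_on UNIV"
    and "hyper_order f < \<infinity>"
    and "\<not> (\<exists>n::nat. n \<ge> 1 \<and> hyper_order f = ereal (real n))"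
    and "share_CM f (deriv f) a"
  shows "\<exists>\<phi>. (\<forall>z. deriv f z - a = exp (\<phi> z) * (f z - a)) \<and>
           (\<phi> constant_on UNIV \<or> transcendental_entire \<phi> \<and> growth_order \<phi> < \<infinity>)"
proof -
  note f = assms(1)
  have df: "deriv f holomorphic_on UNIV" using holomorphic_deriv[OF f] by simp
  have zeros: "f z - a = 0 \<longleftrightarrow> deriv f z - a = 0" for z
    using assms(5) by (auto simp: share_CM_def)
  have nconst: "\<exists>z. f z \<noteq> a" using assms(2) by (auto simp: constant_on_def)
  have ord: "zorder (\<lambda>w. f w - a) z = zorder (\<lambda>w. deriv f w - a) z" for z
  proof (cases "f z - a = 0")
    case True
    then show ?thesis using assms(5) by (auto simp: share_CM_def)
  next
    case False
    then have nz: "f z - a \<noteq> 0" "deriv f z - a \<noteq> 0" using zeros by auto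
    have an: "f analytic_on {z}" "deriv f analytic_on {z}"
      using holomorphic_on_imp_analytic_at[OF f open_UNIV] holomorphic_on_imp_analytic_at[OF df open_UNIV]
      by simp_all
    have "zorder (\<lambda>w. f w - a) z = 0"
      by (rule zorder_eq_0I) (use nz an in \<open>auto intro!: analytic_intros\<close>)
    moreover have "zorder (\<lambda>w. deriv f w - a) z = 0"
      by (rule zorder_eq_0I) (use nz an in \<open>auto intro!: analytic_intros\<close>)
    ultimately show ?thesis by simp
  qed
  obtain h where h: "h holomorphic_on UNIV" "\<And>z. h z \<noteq> 0" "\<And>z. deriv f z - a = h z * (f z - a)"
  proof (rule holomorphic_zorder_factorization[of "\<lambda>w. deriv f w - a" UNIV "\<lambda>w. f w - a"])
  qed (use ord zeros f df in \<open>auto intro!: holomorphic_intros\<close>)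
  obtain \<phi> where \<phi>: "\<phi> holomorphic_on UNIV" "\<And>z. exp (\<phi> z) = h z"
    using holomorphic_logarithm_exists[of UNIV h 0] h by auto
  have eq: "deriv f z - a = exp (\<phi> z) * (f z - a)" for z using h(3) \<phi>(2) by simp
  have simple: "deriv f z \<noteq> 0" if z: "f z = a" for z
  proof (cases "a = 0")
    case False
    \<comment> \<open>at a common \<open>a\<close>-point the derivative is \<open>a\<close> itself\<close>
    then show ?thesis using zeros[of z] z by auto
  next
    case True
    \<comment> \<open>\<open>f' = exp \<phi> * f\<close> makes \<open>f\<close> a constant multiple of \<open>exp A\<close>, which has no zeros\<close>
    obtain A where A: "\<And>x. (A has_field_derivative exp (\<phi> x)) (at x)"
      using holomorphic_convex_primitive'[of UNIV "\<lambda>x. exp (\<phi> x)"] \<phi>(1)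
      by (auto intro!: holomorphic_intros)
    have "((\<lambda>w. f w * exp (- A w)) has_field_derivative 0) (at x)" for x
    proof -
      have "(f has_field_derivative exp (\<phi> x) * f x) (at x)"
        using holomorphic_derivI[OF f, of x] eq[of x] True by simp
      then show ?thesis by (auto intro!: derivative_eq_intros A)
    qed
    then have "f w * exp (- A w) = f z * exp (- A z)" for w
      using has_field_derivative_zero_constant[of UNIV "\<lambda>w. f w * exp (- A w)"] by (metis UNIV_I convex_UNIV)
    then have "f w = 0" for w using z True by simp
    then show ?thesis using nconst True by simp
  qed
  have order: "growth_order \<phi> < \<infinity>"
    using nconst log_quotient_finite_order[OF f \<phi>(1) assms(3) eq simple] by blast
  have "\<phi> constant_on UNIV \<or> transcendental_entire \<phi>"
  proof (rule ccontr)
    assume neg: "\<not> ?thesis"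
    then obtain p where p: "\<phi> = poly p" using \<phi>(1) by (auto simp: transcendental_entire_def)
    have deg: "degree p > 0"
    proof (rule ccontr)
      assume "\<not> degree p > 0"
      then obtain c where "p = [:c:]" by (auto elim: degree_eq_zeroE)
      then show False using neg p by (auto simp: constant_on_def)
    qed
    define n where "n = degree p"
    have le: "hyper_order f \<le> ereal (real n)"
      unfolding n_def by (rule hyper_order_poly_ode_le[OF f]) (use eq p in simp)
    have "hyper_order f \<noteq> ereal (real n)" using assms(4) deg by (auto simp: n_def)
    then have "hyper_order f < ereal (real n)" using le by simp
    then obtain s0 where s0: "hyper_order f < ereal s0" "s0 < real n"
      using ereal_dense2[of "hyper_order f" "ereal (real n)"] by auto
    define s where "s = max s0 (real n / 2)"
    have s: "s > 0" "s < real n" "hyper_order f < ereal s"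
      using s0 deg by (auto simp: s_def n_def less_max_iff_disj)
    obtain r where r: "\<And>z. norm z \<ge> r \<Longrightarrow> norm (f z) \<le> exp (exp (norm z powr s))"
      using hyper_order_less_imp_bound[OF s(3,1)] by blast
    have "f z - a = 0" for z
    proof (rule poly_ode_slow_growth_imp_zero[where F = "\<lambda>z. f z - a" and a = a, OF _ deg])
      show "(\<lambda>z. f z - a) holomorphic_on UNIV" by (intro holomorphic_intros f)
      have d: "deriv (\<lambda>z. f z - a) z = deriv f z" for z
        using holomorphic_derivI[OF f, of z] by (intro DERIV_imp_deriv) (auto intro!: derivative_eq_intros)
      show "deriv (\<lambda>z. f z - a) z = exp (poly p z) * (f z - a) + a" for z
        using eq[of z] unfolding d p by (simp add: algebra_simps)
    next
      fix d :: real assume d: "d > 0"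
      define b where "b = norm a"
      have "b \<ge> 0" by (simp add: b_def)
      have "eventually (\<lambda>x::real. exp (exp (x powr s)) + b \<le> exp (exp (d * x powr real n))) at_top"
        using d s \<open>b \<ge> 0\<close> by real_asymp
      then have "eventually (\<lambda>z::complex. exp (exp (norm z powr s)) + b \<le> exp (exp (d * norm z powr real n))) at_infinity"
        using filterlim_norm_at_top filterlim_iff by blast
      then obtain X where X: "\<And>z::complex. norm z \<ge> X \<Longrightarrow>
          exp (exp (norm z powr s)) + b \<le> exp (exp (d * norm z powr real n))"
        by (auto simp: eventually_at_infinity)
      show "\<exists>X. \<forall>z. X \<le> norm z \<longrightarrow> norm (f z - a) \<le> exp (exp (d * norm z ^ degree p))"
      proof (intro exI[of _ "max 1 (max r X)"] allI impI)
        fix z :: complex assume z: "max 1 (max r X) \<le> norm z"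
        have "norm (f z - a) \<le> norm (f z) + b" unfolding b_def by (rule norm_triangle_ineq4)
        also have "norm (f z) \<le> exp (exp (norm z powr s))" using r z by auto
        also have "exp (exp (norm z powr s)) + b \<le> exp (exp (d * norm z powr real n))"
          using X[of z] z by auto
        also have "norm z powr real n = norm z ^ degree p"
          using z by (subst powr_realpow) (auto simp: n_def)
        finally show "norm (f z - a) \<le> exp (exp (d * norm z ^ degree p))" by simp
      qed
    qed
    then show False using nconst by auto
  qed
  then show ?thesis using eq order by blast
qed

end
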